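(* For every $n\ge 1$ and $i\in\{1,2\}$, $s_i(n,\# P_5,S_4)\le 6$. Moreover, $s_2(n,\# P_5,S_4)\ge 5$ whenever $n=4k$ with $k\ge 2$, or $n=4k+1$ with $k\ge 1$.
   Context: For graphs $F$ and $H$, the $F$-saturation game on $n$ vertices is played by Max and Mini, who alternately claim previously unclaimed edges of $K_n$ so that the graph $G$ of claimed edges stays $F$-free; the game ends when $G$ is $F$-saturated. The $H$-score is the number of (not necessarily induced) subgraphs of the final $G$ isomorphic to $H$. Max maximizes, Mini minimizes the score; $s_1(n,\# H,F)$ is the optimal score when Max starts, $s_2(n,\# H,F)$ when Mini starts. $P_5$ is the path on 5 vertices and $S_4$ the star on 4 vertices. *)

theory Defs
  imports Main
begin

section \<open>Simple graphs\<close>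

record 'a graph =
  verts :: "'a set"
  edges :: "'a set set"

definition pairs :: "'a set \<Rightarrow> 'a set set" where
  "pairs V = {e. e \<subseteq> V \<and> card e = 2}"

definition simple_graph :: "'a graph \<Rightarrow> bool" where
  "simple_graph G \<longleftrightarrow> finite (verts G) \<and> edges G \<subseteq> pairs (verts G)"

definition subgraph :: "'a graph \<Rightarrow> 'a graph \<Rightarrow> bool" where
  "subgraph K G \<longleftrightarrow> simple_graph K \<and> verts K \<subseteq> verts G \<and> edges K \<subseteq> edges G"

definition isomorphic :: "'a graph \<Rightarrow> 'b graph \<Rightarrow> bool" where
  "isomorphic H K \<longleftrightarrow>
     (\<exists>f. bij_betw f (verts H) (verts K) \<and> (\<lambda>e. f ` e) ` edges H = edges K)"

definition copies :: "'b graph \<Rightarrow> 'a graph \<Rightarrow> 'a graph set" where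
  "copies H G = {K. subgraph K G \<and> isomorphic H K}"

definition free :: "'b graph \<Rightarrow> 'a graph \<Rightarrow> bool" where
  "free F G \<longleftrightarrow> copies F G = {}"

definition add_edge :: "'a set \<Rightarrow> 'a graph \<Rightarrow> 'a graph" where
  "add_edge e G = G\<lparr>edges := insert e (edges G)\<rparr>"

definition saturated :: "'b graph \<Rightarrow> 'a graph \<Rightarrow> bool" where
  "saturated F G \<longleftrightarrow>
     free F G \<and> (\<forall>e \<in> pairs (verts G) - edges G. \<not> free F (add_edge e G))"

text \<open>The argument of both constructors is the number of vertices: the star on \<open>k\<close> vertices
  has \<open>k - 1\<close> leaves.\<close>

definition path_graph :: "nat \<Rightarrow> nat graph" where
  "path_graph k = \<lparr>verts = {..<k}, edges = {{i, Suc i} |i. Suc i < k}\<rparr>"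

definition star_graph :: "nat \<Rightarrow> nat graph" where
  "star_graph k = \<lparr>verts = {..<k}, edges = {{0, i} |i. 0 < i \<and> i < k}\<rparr>"


section \<open>The saturation game\<close>

datatype player = Maxi | Mini

fun opponent :: "player \<Rightarrow> player" where
  "opponent Maxi = Mini"
| "opponent Mini = Maxi"

definition position :: "nat \<Rightarrow> nat set set \<Rightarrow> nat graph" where
  "position n E = \<lparr>verts = {..<n}, edges = E\<rparr>"

definition legal_moves :: "nat \<Rightarrow> 'b graph \<Rightarrow> nat set set \<Rightarrow> nat set set" where
  "legal_moves n F E = {e \<in> pairs {..<n} - E. free F (add_edge e (position n E))}"

text \<open>\<open>game_value n H F p E\<close> is the \<open>H\<close>-score under optimal play from the position with claimed
  edges \<open>E\<close> and \<open>p\<close> to move. It is meaningful for \<open>F\<close>-free positions only; there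
  \<open>Max\<close> and \<open>Min\<close> are never applied to the empty set, see \<open>legal_moves_nonempty\<close> below.\<close>

function game_value ::
  "nat \<Rightarrow> 'c graph \<Rightarrow> 'b graph \<Rightarrow> player \<Rightarrow> nat set set \<Rightarrow> nat" where
  "game_value n H F p E =
     (if saturated F (position n E) then card (copies H (position n E))
      else (case p of Maxi \<Rightarrow> Max | Mini \<Rightarrow> Min)
             ((\<lambda>e. game_value n H F (opponent p) (insert e E)) ` legal_moves n F E))"
  by pat_completeness auto

lemma finite_pairs: "finite V \<Longrightarrow> finite (pairs V)"
  by (rule finite_subset[of _ "Pow V"]) (auto simp: pairs_def)

termination
proof (relation "measure (\<lambda>(n, H, F, p, E). card (pairs {..<n} - E))", goal_cases)
  case 1
  show ?case by simp
next
  case (2 n H F p E e)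
  then have "pairs {..<n} - insert e E \<subset> pairs {..<n} - E"
    by (auto simp: legal_moves_def)
  then show ?case
    by (simp add: psubset_card_mono finite_pairs)
qed

declare game_value.simps [simp del]

lemma legal_moves_nonempty:
  assumes "free F (position n E)" and "\<not> saturated F (position n E)"
  shows "legal_moves n F E \<noteq> {}"
  using assms by (auto simp: saturated_def legal_moves_def position_def)

definition s1 :: "nat \<Rightarrow> 'c graph \<Rightarrow> 'b graph \<Rightarrow> nat" where
  "s1 n H F = game_value n H F Maxi {}"

definition s2 :: "nat \<Rightarrow> 'c graph \<Rightarrow> 'b graph \<Rightarrow> nat" where
  "s2 n H F = game_value n H F Mini {}"

end

theory Submission
  imports Defs
begin

text \<open>A graph is \<open>S\<^sub>4\<close>-free iff its degrees are at most two, and then a copy of \<open>P\<^sub>5\<close> is determined by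
  its middle vertex, so the score is the number of middle vertices: the vertices on cycles of length
  at least five, once the game is over.

  Upper bound: as long as isolated vertices remain, Mini leaves only single edges and cycles on at
  most four vertices, closing at once every path on three or four vertices that Max creates. When
  the isolated vertices have run out, Mini may be forced to leave one path on three or four
  vertices. Max can extend it only by a single edge, and Mini closes the result to a cycle on five
  or six vertices; from then on Max has to join two single edges whenever he can, and Mini closes the four-cycle.

  Lower bound: Max keeps the claimed edges a matching with an even number of edges, until Mini, who
  runs out of pairs of isolated vertices first, creates a longer path, which Max extends to a
  \<open>P\<^sub>5\<close>. The final graph contains it inside a cycle.\<close>

section \<open>Degrees and star-free graphs\<close>

definition deg :: "'a set set \<Rightarrow> 'a \<Rightarrow> nat" where
  "deg E v = card {e \<in> E. v \<in> e}"

lemma pairsD: "e \<in> pairs V \<Longrightarrow> v \<in> e \<Longrightarrow> \<exists>w. w \<noteq> v \<and> e = {v, w} \<and> v \<in> V \<and> w \<in> V"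
  unfolding pairs_def card_2_iff by auto

lemma doubleton_in_pairs [simp]: "{x, y} \<in> pairs V \<longleftrightarrow> x \<noteq> y \<and> x \<in> V \<and> y \<in> V"
  by (auto simp: pairs_def card_2_iff doubleton_eq_iff)

lemma finite_subset_pairs: "E \<subseteq> pairs {..<n::nat} \<Longrightarrow> finite E"
  by (meson finite_lessThan finite_pairs finite_subset)

lemma deg_insert:
  assumes "finite E" "e \<notin> E"
  shows "deg (insert e E) v = (if v \<in> e then Suc (deg E v) else deg E v)"
proof -
  have "{f \<in> insert e E. v \<in> f} = (if v \<in> e then insert e {f \<in> E. v \<in> f} else {f \<in> E. v \<in> f})"
    by auto
  then show ?thesis using assms by (simp add: deg_def)
qed

lemma deg_Un:
  assumes "\<Union>A \<inter> \<Union>B = {}"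
  shows "deg (A \<union> B) v = (if v \<in> \<Union>A then deg A v else deg B v)"
proof -
  have "{e \<in> A \<union> B. v \<in> e} = (if v \<in> \<Union>A then {e \<in> A. v \<in> e} else {e \<in> B. v \<in> e})"
    using assms by auto
  then show ?thesis by (simp add: deg_def)
qed

lemma deg_eq_0: "v \<notin> \<Union>E \<Longrightarrow> deg E v = 0"
  by (auto simp: deg_def card_eq_0_iff)

lemma deg_eq_0_iff: "finite E \<Longrightarrow> deg E v = 0 \<longleftrightarrow> v \<notin> \<Union>E"
  by (auto simp: deg_def card_eq_0_iff)

lemma edges_star_graph_4: "edges (star_graph 4) = {{0, 1}, {0, 2}, {0, 3}}"
proof -
  have "{i. 0 < i \<and> i < (4::nat)} = {1, 2, 3}" by auto
  moreover have "edges (star_graph 4) = (\<lambda>i. {0, i}) ` {i. 0 < i \<and> i < (4::nat)}"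
    by (auto simp: star_graph_def)
  ultimately show ?thesis by simp
qed

lemma edges_path_graph_5: "edges (path_graph 5) = {{0, 1}, {1, 2}, {2, 3}, {3, 4}}"
proof -
  have "{i. Suc i < 5} = {0, 1, 2, 3}" by auto
  moreover have "edges (path_graph 5) = (\<lambda>i. {i, Suc i}) ` {i. Suc i < 5}"
    by (auto simp: path_graph_def)
  ultimately show ?thesis by (simp add: numeral_eq_Suc)
qed

text \<open>A copy of the star gives three distinct edges at the image of its centre; conversely,
  three edges at one vertex of a simple graph have three distinct other ends, which serve as
  leaves.\<close>

lemma free_star_iff:
  assumes E: "E \<subseteq> pairs {..<n}"
  shows "free (star_graph 4) (position n E) \<longleftrightarrow> (\<forall>v. deg E v \<le> 2)"
proof
  assume fr: "free (star_graph 4) (position n E)"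
  show "\<forall>v. deg E v \<le> 2"
  proof (rule ccontr)
    assume "\<not> (\<forall>v. deg E v \<le> 2)"
    then obtain v where "3 \<le> card {e \<in> E. v \<in> e}"
      by (auto simp: deg_def not_le numeral_3_eq_3 Suc_le_eq numeral_2_eq_2)
    then obtain T where T: "T \<subseteq> {e \<in> E. v \<in> e}" "card T = 3"
      by (meson obtain_subset_with_card_n)
    then obtain e1 e2 e3 where e: "T = {e1, e2, e3}" "e1 \<noteq> e2" "e2 \<noteq> e3" "e1 \<noteq> e3"
      by (auto simp: card_3_iff)
    have *: "\<exists>a. a \<noteq> v \<and> e = {v, a} \<and> v < n \<and> a < n" if "e \<in> T" for e
      using that T(1) E pairsD[of e "{..<n}" v] by auto
    obtain a1 a2 a3 where a: "e1 = {v, a1}" "e2 = {v, a2}" "e3 = {v, a3}"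
      "a1 \<noteq> v" "a2 \<noteq> v" "a3 \<noteq> v" "v < n" "a1 < n" "a2 < n" "a3 < n"
      using *[of e1] *[of e2] *[of e3] e(1) by auto
    \<comment> \<open>The list has the centre in position 0, so \<open>(!) ?xs\<close> is the
      required isomorphism.\<close>
    let ?xs = "[v, a1, a2, a3]"
    let ?K = "\<lparr>verts = set ?xs, edges = T\<rparr>"
    have "distinct ?xs" using a e by auto
    then have "bij_betw ((!) ?xs) {..<4} (set ?xs)"
      by (rule bij_betw_nth) auto
    moreover have "(\<lambda>e. (!) ?xs ` e) ` edges (star_graph 4) = T"
      by (simp add: edges_star_graph_4 e a)
    ultimately have "isomorphic (star_graph 4) ?K"
      unfolding isomorphic_def by (intro exI[of _ "(!) ?xs"]) (simp add: star_graph_def)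
    moreover have "subgraph ?K (position n E)"
      using T(1) a e by (auto simp: subgraph_def simple_graph_def position_def)
    ultimately show False using fr by (auto simp: free_def copies_def)
  qed
next
  assume d: "\<forall>v. deg E v \<le> 2"
  show "free (star_graph 4) (position n E)"
  proof (rule ccontr)
    assume "\<not> free (star_graph 4) (position n E)"
    then obtain K where K: "subgraph K (position n E)" "isomorphic (star_graph 4) K"
      by (auto simp: free_def copies_def)
    then obtain f where f: "bij_betw f {..<4} (verts K)"
      "(\<lambda>e. f ` e) ` edges (star_graph 4) = edges K"
      by (auto simp: isomorphic_def star_graph_def)
    have inj: "inj_on f {..<4}" using f(1) by (simp add: bij_betw_def)
    have "f 1 \<noteq> f 2" "f 1 \<noteq> f 3" "f 2 \<noteq> f 3"
      using inj by (simp_all add: inj_on_eq_iff)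
    then have "card {{f 0, f 1}, {f 0, f 2}, {f 0, f 3}} = 3"
      by (auto simp: doubleton_eq_iff card_3_iff)
    moreover have "{{f 0, f 1}, {f 0, f 2}, {f 0, f 3}} \<subseteq> {e \<in> E. f 0 \<in> e}"
      using f(2) K(1) by (auto simp: edges_star_graph_4 subgraph_def position_def)
    moreover have "finite {e \<in> E. f 0 \<in> e}"
      using finite_subset_pairs[OF E] by simp
    ultimately have "3 \<le> deg E (f 0)"
      unfolding deg_def by (metis (lifting) card_mono)
    with spec[OF d, of "f 0"] show False by linarith
  qed
qed

section \<open>Copies of the path on five vertices\<close>

definition path5 :: "'a set set \<Rightarrow> 'a \<Rightarrow> 'a \<Rightarrow> 'a \<Rightarrow> 'a \<Rightarrow> 'a \<Rightarrow> bool" where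
  "path5 E a b c d e \<longleftrightarrow> distinct [a, b, c, d, e] \<and> {{a, b}, {b, c}, {c, d}, {d, e}} \<subseteq> E"

definition path5_graph :: "'a \<Rightarrow> 'a \<Rightarrow> 'a \<Rightarrow> 'a \<Rightarrow> 'a \<Rightarrow> 'a graph" where
  "path5_graph a b c d e =
     \<lparr>verts = {a, b, c, d, e}, edges = {{a, b}, {b, c}, {c, d}, {d, e}}\<rparr>"

definition mids :: "'a set set \<Rightarrow> 'a set" where
  "mids E = {c. \<exists>a b d e. path5 E a b c d e}"

lemma path5_rev: "path5 E a b c d e \<Longrightarrow> path5 E e d c b a"
  by (auto simp: path5_def insert_commute)

lemma path5_edges:
  assumes "path5 E a b c d e"
  shows "{a, b} \<in> E" "{b, a} \<in> E" "{b, c} \<in> E" "{c, b} \<in> E"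
    "{c, d} \<in> E" "{d, c} \<in> E" "{d, e} \<in> E" "{e, d} \<in> E" "distinct [a, b, c, d, e]"
  using assms by (simp_all add: path5_def insert_commute)

lemma path5_graph_rev: "path5_graph a b c d e = path5_graph e d c b a"
  unfolding path5_graph_def by (simp add: insert_commute)

lemma copies_path_graph_5:
  assumes E: "E \<subseteq> pairs {..<n}"
  shows "copies (path_graph 5) (position n E) =
    {path5_graph a b c d e | a b c d e. path5 E a b c d e}"
proof (intro equalityI subsetI)
  fix K assume "K \<in> copies (path_graph 5) (position n E)"
  then obtain f where K: "subgraph K (position n E)" and f: "bij_betw f {..<5} (verts K)"
      "(\<lambda>e. f ` e) ` edges (path_graph 5) = edges K"
    by (auto simp: copies_def isomorphic_def path_graph_def)
  have "{..<5} = {0, 1, 2, 3, 4::nat}" by auto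
  then have V: "verts K = {f 0, f 1, f 2, f 3, f 4}"
    using f(1) by (auto simp: bij_betw_def)
  have D: "edges K = {{f 0, f 1}, {f 1, f 2}, {f 2, f 3}, {f 3, f 4}}"
    using f(2) by (auto simp: edges_path_graph_5)
  have "inj_on f {..<5}" using f(1) by (simp add: bij_betw_def)
  then have "distinct [f 0, f 1, f 2, f 3, f 4]" by (simp add: inj_on_eq_iff)
  moreover have "edges K \<subseteq> E" using K by (simp add: subgraph_def position_def)
  ultimately have "path5 E (f 0) (f 1) (f 2) (f 3) (f 4)"
    using D by (simp add: path5_def)
  moreover have "K = path5_graph (f 0) (f 1) (f 2) (f 3) (f 4)"
    using V D by (simp add: path5_graph_def)
  ultimately show "K \<in> {path5_graph a b c d e | a b c d e. path5 E a b c d e}"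
    by blast
next
  fix K assume "K \<in> {path5_graph a b c d e | a b c d e. path5 E a b c d e}"
  then obtain a b c d e where K: "K = path5_graph a b c d e" and p: "path5 E a b c d e"
    by blast
  let ?xs = "[a, b, c, d, e]"
  have "bij_betw ((!) ?xs) {..<5} (set ?xs)"
    using p by (intro bij_betw_nth) (simp_all add: path5_def)
  moreover have "(\<lambda>e. (!) ?xs ` e) ` edges (path_graph 5) = edges K"
    by (simp add: edges_path_graph_5 K path5_graph_def)
  ultimately have "isomorphic (path_graph 5) K"
    unfolding isomorphic_def
    by (intro exI[of _ "(!) ?xs"]) (simp add: path_graph_def path5_graph_def K)
  moreover have "{{a, b}, {b, c}, {c, d}, {d, e}} \<subseteq> pairs {..<n}"
    using p E unfolding path5_def by blast
  then have "subgraph K (position n E)"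
    using p by (auto simp: subgraph_def simple_graph_def position_def K path5_graph_def path5_def)
  ultimately show "K \<in> copies (path_graph 5) (position n E)"
    by (simp add: copies_def)
qed

text \<open>Lets the middle vertex be read off the subgraph itself, in whichever direction the path
  was written. A middle vertex has two neighbours, each with a further neighbour: the ends fail the
  first condition, \<open>b\<close> and \<open>d\<close> the second.\<close>

lemma mids_edges_path5_graph:
  assumes "distinct [a, b, c, d, e]"
  shows "mids (edges (path5_graph a b c d e)) = {c}"
proof (intro equalityI subsetI)
  fix z assume "z \<in> mids (edges (path5_graph a b c d e))"
  then obtain w x y v where p: "path5 (edges (path5_graph a b c d e)) w x z y v"
    by (auto simp: mids_def)
  then have D: "{w, x} \<in> edges (path5_graph a b c d e)" "{z, x} \<in> edges (path5_graph a b c d e)"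
      "{z, y} \<in> edges (path5_graph a b c d e)" "{v, y} \<in> edges (path5_graph a b c d e)"
    and dist: "x \<noteq> y" "w \<noteq> z" "v \<noteq> z"
    by (auto simp: path5_def insert_commute)
  have nb: "(s = a \<longrightarrow> t = b) \<and> (s = b \<longrightarrow> t = a \<or> t = c) \<and> (s = d \<longrightarrow> t = c \<or> t = e) \<and>
      (s = e \<longrightarrow> t = d) \<and> s \<in> {a, b, c, d, e}"
    if "{s, t} \<in> edges (path5_graph a b c d e)" for s t
    using that assms by (auto simp: path5_graph_def doubleton_eq_iff)
  have end_nb: "w = b" if "x = a" using nb[of x w] D(1) that by (simp add: insert_commute)
  have end_nb': "w = d" if "x = e" using nb[of x w] D(1) that by (simp add: insert_commute)
  have end_nb2: "v = b" if "y = a" using nb[of y v] D(4) that by (simp add: insert_commute)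
  have end_nb2': "v = d" if "y = e" using nb[of y v] D(4) that by (simp add: insert_commute)
  have "z \<notin> {a, b, d, e}"
    using nb[OF D(2)] nb[OF D(3)] dist end_nb end_nb' end_nb2 end_nb2' by blast
  moreover have "z \<in> {a, b, c, d, e}" using nb[OF D(2)] by blast
  ultimately show "z \<in> {c}" by simp
next
  fix z assume "z \<in> {c}"
  then have "path5 (edges (path5_graph a b c d e)) a b z d e"
    using assms by (simp add: path5_def path5_graph_def)
  then show "z \<in> mids (edges (path5_graph a b c d e))" by (auto simp: mids_def)
qed

lemma neighbour_unique:
  assumes "finite E" "deg E v \<le> 2" "{v, x} \<in> E" "{v, y} \<in> E" "{v, z} \<in> E" "x \<noteq> y"
  shows "z = x \<or> z = y"
proof (rule ccontr)
  assume "\<not> (z = x \<or> z = y)"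
  then have "{v, x} \<noteq> {v, y}" "{v, x} \<noteq> {v, z}" "{v, y} \<noteq> {v, z}"
    using \<open>x \<noteq> y\<close> by (auto simp: doubleton_eq_iff)
  then have "card {{v, x}, {v, y}, {v, z}} = 3" by simp
  moreover have "card {{v, x}, {v, y}, {v, z}} \<le> deg E v"
    unfolding deg_def using assms by (intro card_mono) auto
  ultimately show False using assms(2) by linarith
qed

text \<open>With degrees at most two, the neighbours of the middle vertex are determined and each
  arm continues in only one way; the only freedom left is the direction of reading.\<close>

lemma path5_graph_determined:
  assumes "finite E" "\<And>v. deg E v \<le> 2" "path5 E a b c d e" "path5 E a' b' c d' e'"
  shows "path5_graph a b c d e = path5_graph a' b' c d' e'"
proof -
  note u = neighbour_unique[OF assms(1,2)]
  note p = path5_edges[OF assms(3)]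
  \<comment> \<open>A common second vertex \<open>b\<close> fixes the direction, and all other
    vertices follow; the opposite direction is reduced to this one by reversal.\<close>
  have *: "a = a2 \<and> d = d2 \<and> e = e2" if "path5 E a2 b c d2 e2" for a2 d2 e2
  proof -
    note q = path5_edges[OF that]
    have d: "d2 = d" using u[OF p(4,5) q(5)] p(9) q(9) by auto
    have "a2 = a" using u[OF p(3,2) q(2)] p(9) q(9) by auto
    moreover have "e2 = e" using u[OF p(6,7) q(7)[unfolded d]] p(9) q(9) by auto
    ultimately show ?thesis using d by simp
  qed
  note q = path5_edges[OF assms(4)]
  have "b' = b \<or> b' = d" using u[OF p(4,5) q(4)] p(9) by auto
  moreover have "d' = b \<or> d' = d" using u[OF p(4,5) q(5)] p(9) by auto
  moreover have "b' \<noteq> d'" using q(9) by auto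
  ultimately consider "b' = b" | "d' = b" by blast
  then show ?thesis
  proof cases
    case 1
    then show ?thesis using *[of a' d' e'] assms(4) by simp
  next
    case 2
    then have "a = e' \<and> d = b' \<and> e = a'" using *[of e' b' a'] path5_rev[OF assms(4)] by simp
    with 2 show ?thesis by (simp add: path5_graph_rev[of a' b'])
  qed
qed

text \<open>Sending a copy to its middle vertex is injective by
  \<open>path5_graph_determined\<close> and onto \<open>mids E\<close> by definition.\<close>

lemma card_copies_path_graph_5:
  assumes E: "E \<subseteq> pairs {..<n}" and d: "\<And>v. deg E v \<le> 2"
  shows "card (copies (path_graph 5) (position n E)) = card (mids E)"
proof -
  let ?C = "copies (path_graph 5) (position n E)"
  let ?g = "\<lambda>K. the_elem (mids (edges K))"
  have g: "?g (path5_graph a b c d e) = c" if "path5 E a b c d e" for a b c d e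
    using that by (simp add: path5_def mids_edges_path5_graph)
  have C: "\<exists>a b c d e. K = path5_graph a b c d e \<and> path5 E a b c d e" if "K \<in> ?C" for K
    using that by (simp add: copies_path_graph_5[OF E])
  have "inj_on ?g ?C"
  proof (rule inj_onI)
    fix K L assume KL: "K \<in> ?C" "L \<in> ?C" and eq: "?g K = ?g L"
    obtain a b c d e where K: "K = path5_graph a b c d e" "path5 E a b c d e"
      using C[OF KL(1)] by (elim exE conjE) (rule that)
    obtain a' b' c' d' e' where L: "L = path5_graph a' b' c' d' e'" "path5 E a' b' c' d' e'"
      using C[OF KL(2)] by (elim exE conjE) (rule that)
    have "c = c'" using eq unfolding K(1) L(1) g[OF K(2)] g[OF L(2)] .
    then show "K = L"
      using path5_graph_determined[OF finite_subset_pairs[OF E] d K(2)] K(1) L by simp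
  qed
  moreover have "?g ` ?C = mids E"
  proof (intro equalityI subsetI)
    fix c assume "c \<in> ?g ` ?C"
    then obtain K where K: "K \<in> ?C" "c = ?g K" by (elim imageE)
    obtain a b c' d e where p: "K = path5_graph a b c' d e" "path5 E a b c' d e"
      using C[OF K(1)] by (elim exE conjE) (rule that)
    have "c = c'" unfolding K(2) p(1) g[OF p(2)] ..
    then show "c \<in> mids E" using p(2) unfolding mids_def by blast
  next
    fix c assume "c \<in> mids E"
    then obtain a b d e where p: "path5 E a b c d e"
      unfolding mids_def by (elim CollectE exE) (rule that)
    have "path5_graph a b c d e \<in> ?C"
      unfolding copies_path_graph_5[OF E] using p by blast
    then show "c \<in> ?g ` ?C" by (rule rev_image_eqI) (rule g[OF p, symmetric])
  qed
  ultimately show ?thesis by (metis card_image)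
qed

section \<open>Playing the star saturation game\<close>

abbreviation legal :: "nat \<Rightarrow> nat set set \<Rightarrow> nat set set" where
  "legal n E \<equiv> legal_moves n (star_graph 4) E"

abbreviation gval :: "nat \<Rightarrow> player \<Rightarrow> nat set set \<Rightarrow> nat" where
  "gval n p E \<equiv> game_value n (path_graph 5) (star_graph 4) p E"

section \<open>Positions and legal moves in terms of degrees\<close>

definition valid :: "nat \<Rightarrow> nat set set \<Rightarrow> bool" where
  "valid n E \<longleftrightarrow> E \<subseteq> pairs {..<n} \<and> (\<forall>v. deg E v \<le> 2)"

lemma validD:
  assumes "valid n E"
  shows "E \<subseteq> pairs {..<n}" "deg E v \<le> 2" "finite E"
  using assms finite_subset_pairs by (auto simp: valid_def)

text \<open>Turns the star-freeness test of the game into the degree condition used from here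
  on.\<close>

lemma legal_alt:
  assumes "valid n E"
  shows "e \<in> legal n E \<longleftrightarrow> e \<notin> E \<and> valid n (insert e E)"
proof -
  have "add_edge e (position n E) = position n (insert e E)"
    by (simp add: add_edge_def position_def)
  then show ?thesis
    using validD(1)[OF assms] free_star_iff[of "insert e E" n]
    by (auto simp: legal_moves_def valid_def)
qed

lemma legal_doubleton_iff:
  assumes "valid n E"
  shows "{x, y} \<in> legal n E \<longleftrightarrow>
    x \<noteq> y \<and> x < n \<and> y < n \<and> {x, y} \<notin> E \<and> deg E x \<le> 1 \<and> deg E y \<le> 1"
proof (cases "{x, y} \<in> E")
  case False
  have "(\<forall>v. (if v \<in> {x, y} then Suc (deg E v) else deg E v) \<le> 2) \<longleftrightarrow>
      deg E x \<le> 1 \<and> deg E y \<le> 1"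
    using validD(2)[OF assms] by auto
  then show ?thesis
    using False validD(1)[OF assms] deg_insert[OF validD(3)[OF assms] False]
    unfolding legal_alt[OF assms] valid_def by auto
qed (simp add: legal_alt[OF assms])

lemma legalE:
  assumes "e \<in> legal n E" "valid n E"
  obtains x y where "e = {x, y}" "x \<noteq> y" "x < n" "y < n" "{x, y} \<notin> E"
    "deg E x \<le> 1" "deg E y \<le> 1"
proof -
  have "e \<in> pairs {..<n}" using assms(1) by (simp add: legal_moves_def)
  then obtain x y where "e = {x, y}" by (auto simp: pairs_def card_2_iff)
  then show thesis using that assms legal_doubleton_iff by metis
qed

lemma saturated_iff_no_legal:
  assumes "valid n E"
  shows "saturated (star_graph 4) (position n E) \<longleftrightarrow> legal n E = {}"
proof -
  have "verts (position n E) = {..<n}" "edges (position n E) = E"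
    by (simp_all add: position_def)
  then show ?thesis
    using free_star_iff[OF validD(1)[OF assms]] validD(2)[OF assms]
    by (auto simp: saturated_def legal_moves_def)
qed

lemma finite_legal: "finite (legal n E)"
  unfolding legal_moves_def by (simp add: finite_pairs)

section \<open>One-step bounds and invariants for the game value\<close>

lemma gval_terminal:
  assumes "valid n E" "legal n E = {}"
  shows "gval n p E = card (mids E)"
  using assms saturated_iff_no_legal[OF assms(1)]
    card_copies_path_graph_5[OF validD(1,2)[OF assms(1)]]
  by (subst game_value.simps) simp

lemma gval_Maxi:
  assumes "valid n E" "legal n E \<noteq> {}"
  shows "gval n Maxi E = Max ((\<lambda>e. gval n Mini (insert e E)) ` legal n E)"
  using assms saturated_iff_no_legal[OF assms(1)] by (subst game_value.simps) simp

lemma gval_Mini: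
  assumes "valid n E" "legal n E \<noteq> {}"
  shows "gval n Mini E = Min ((\<lambda>e. gval n Maxi (insert e E)) ` legal n E)"
  using assms saturated_iff_no_legal[OF assms(1)] by (subst game_value.simps) simp

lemma gval_Mini_le:
  assumes "valid n E" "e \<in> legal n E" "gval n Maxi (insert e E) \<le> k"
  shows "gval n Mini E \<le> k"
proof -
  have "gval n Mini E \<le> gval n Maxi (insert e E)"
    using assms(2) finite_legal[of n E] gval_Mini[OF assms(1)] by (metis (lifting) Min_le empty_iff finite_imageI imageI)
  with assms(3) show ?thesis by simp
qed

lemma gval_Maxi_ge:
  assumes "valid n E" "e \<in> legal n E" "k \<le> gval n Mini (insert e E)"
  shows "k \<le> gval n Maxi E"
proof -
  have "gval n Mini (insert e E) \<le> gval n Maxi E"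
    using assms(2) finite_legal[of n E] gval_Maxi[OF assms(1)] by (metis (lifting) Max_ge empty_iff finite_imageI imageI)
  with assms(3) show ?thesis by simp
qed

lemma gval_Maxi_le:
  assumes "valid n E" "legal n E = {} \<Longrightarrow> card (mids E) \<le> k"
    "\<And>e. e \<in> legal n E \<Longrightarrow> gval n Mini (insert e E) \<le> k"
  shows "gval n Maxi E \<le> k"
  using assms gval_terminal[of n E Maxi] gval_Maxi[of n E] finite_legal[of n E]
  by (cases "legal n E = {}") auto

lemma gval_Mini_ge:
  assumes "valid n E" "legal n E = {} \<Longrightarrow> k \<le> card (mids E)"
    "\<And>e. e \<in> legal n E \<Longrightarrow> k \<le> gval n Maxi (insert e E)"
  shows "k \<le> gval n Mini E"
  using assms gval_terminal[of n E Mini] gval_Mini[of n E] finite_legal[of n E]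
  by (cases "legal n E = {}") auto

lemma card_unclaimed_less:
  assumes "e \<in> legal n E"
  shows "card (pairs {..<n} - insert e E) < card (pairs {..<n} - E)"
  using assms finite_pairs[of "{..<n}"] unfolding legal_moves_def
  by (intro psubset_card_mono) auto

text \<open>\<open>good\<close> is an invariant of positions with Max to move; the induction is on
  the number of unclaimed pairs. \<open>bound\<close> covers games that end with Max to move, the
  first branch of \<open>reply\<close> those that end with Mini to move.\<close>

lemma Mini_strategy:
  assumes valid: "\<And>E. good E \<Longrightarrow> valid n E"
    and bound: "\<And>E. good E \<Longrightarrow> legal n E = {} \<Longrightarrow> card (mids E) \<le> k"
    and reply: "\<And>E e. good E \<Longrightarrow> e \<in> legal n E \<Longrightarrow>
      (if legal n (insert e E) = {} then card (mids (insert e E)) \<le> k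
       else \<exists>e' \<in> legal n (insert e E). good (insert e' (insert e E)))"
    and "good E"
  shows "gval n Maxi E \<le> k"
  using \<open>good E\<close>
proof (induction "card (pairs {..<n} - E)" arbitrary: E rule: less_induct)
  case less
  show ?case
  proof (rule gval_Maxi_le)
    fix e assume e: "e \<in> legal n E"
    have v: "valid n (insert e E)" using e legal_alt valid[OF less.prems] by blast
    show "gval n Mini (insert e E) \<le> k"
    proof (cases "legal n (insert e E) = {}")
      case True
      then show ?thesis using reply[OF less.prems e] gval_terminal[OF v] by simp
    next
      case False
      then obtain e' where e': "e' \<in> legal n (insert e E)" "good (insert e' (insert e E))"
        using reply[OF less.prems e] by auto
      have "gval n Maxi (insert e' (insert e E)) \<le> k"
        using less.hyps[OF _ e'(2)] card_unclaimed_less[OF e] card_unclaimed_less[OF e'(1)] by simp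
      then show ?thesis by (rule gval_Mini_le[OF v e'(1)])
    qed
  qed (use less.prems valid bound in auto)
qed

section \<open>A claimed path on five vertices is worth five copies\<close>

lemma handshake:
  assumes "E \<subseteq> pairs V" "finite V"
  shows "(\<Sum>v\<in>V. deg E v) = 2 * card E"
proof -
  have fin: "finite E" using assms finite_pairs finite_subset by blast
  have "(\<Sum>v\<in>V. deg E v) = (\<Sum>v\<in>V. \<Sum>e\<in>E. if v \<in> e then 1 else 0)"
    using fin by (simp add: deg_def sum.If_cases Int_def)
  also have "\<dots> = (\<Sum>e\<in>E. \<Sum>v\<in>V. if v \<in> e then 1 else 0)" by (rule sum.swap)
  also have "\<dots> = (\<Sum>e\<in>E. 2)"
  proof (rule sum.cong)
    fix e assume "e \<in> E"
    then have "e \<subseteq> V" "card e = 2" using assms by (auto simp: pairs_def)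
    then show "(\<Sum>v\<in>V. if v \<in> e then 1 else 0) = (2::nat)"
      using assms(2) by (simp add: sum.If_cases Int_absorb1)
  qed simp
  finally show ?thesis by simp
qed

lemma deg_ge_1: "finite E \<Longrightarrow> {v, x} \<in> E \<Longrightarrow> 1 \<le> deg E v"
  using deg_eq_0_iff[of E v] by fastforce

lemma deg_ge_2:
  assumes "finite E" "{v, x} \<in> E" "{v, y} \<in> E" "x \<noteq> y"
  shows "2 \<le> deg E v"
proof -
  have "{v, x} \<noteq> {v, y}" using assms(4) by (auto simp: doubleton_eq_iff)
  then have "card {{v, x}, {v, y}} = 2" by simp
  moreover have "card {{v, x}, {v, y}} \<le> deg E v"
    unfolding deg_def using assms by (intro card_mono) auto
  ultimately show ?thesis by simp
qed

text \<open>In a saturated graph two vertices of degree at most one are adjacent. So a path end of degree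
  one would be the only vertex of odd degree.\<close>

lemma path5_end_deg:
  assumes v: "valid n E" and sat: "legal n E = {}" and p: "path5 E a b c d e"
  shows "deg E a = 2"
proof (rule ccontr)
  assume "deg E a \<noteq> 2"
  note q = path5_edges[OF p] and fin = validD(3)[OF v]
  have da: "deg E a = 1"
    using \<open>deg E a \<noteq> 2\<close> validD(2)[OF v, of a] deg_ge_1[OF fin q(1)] by simp
  have an: "a < n" using q(1) validD(1)[OF v] by auto
  have "deg E w = 2" if w: "w < n" "w \<noteq> a" for w
  proof (cases "w = b")
    case True
    then show ?thesis using deg_ge_2[OF fin q(2,3)] q(9) validD(2)[OF v, of b] by simp
  next
    case False
    have "{a, w} \<notin> E" using deg_ge_2[OF fin q(1), of w] False da by auto
    then have "\<not> deg E w \<le> 1"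
      using sat legal_doubleton_iff[OF v, of a w] w an da by auto
    then show ?thesis using validD(2)[OF v, of w] by simp
  qed
  then have "(\<Sum>w\<in>{..<n} - {a}. deg E w) = (\<Sum>w\<in>{..<n} - {a}. 2)"
    by (intro sum.cong) auto
  then have "(\<Sum>w\<in>{..<n}. deg E w) = 1 + 2 * card ({..<n} - {a})"
    using sum.remove[of "{..<n}" a "deg E"] an da by simp
  then have "2 * card E = 1 + 2 * card ({..<n} - {a})"
    using handshake[OF validD(1)[OF v]] by simp
  then show False by presburger
qed

text \<open>The end \<open>a\<close> has degree two, hence a second neighbour \<open>f\<close>. It
  is neither \<open>c\<close> nor \<open>d\<close>, whose two neighbours lie on the path already;
  \<open>f = e\<close> is possible and harmless, because the new path drops
  \<open>e\<close>.\<close>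

lemma path5_shift:
  assumes v: "valid n E" and "legal n E = {}" and p: "path5 E a b c d e"
  shows "\<exists>f. path5 E f a b c d"
proof -
  note q = path5_edges[OF p] and u = neighbour_unique[OF validD(3,2)[OF v]]
  have "card {s \<in> E. a \<in> s} = 2" using path5_end_deg[OF assms] by (simp add: deg_def)
  then obtain s t where st: "{s \<in> E. a \<in> s} = {s, t}" "s \<noteq> t" by (auto simp: card_2_iff)
  then obtain r where r: "r \<in> E" "a \<in> r" "r \<noteq> {a, b}" by blast
  then obtain f where f: "r = {a, f}" "f \<noteq> a" using pairsD[of r "{..<n}" a] validD(1)[OF v] by blast
  have "f \<noteq> b" using r f by auto
  have af: "{a, f} \<in> E" "{f, a} \<in> E" using r f by (auto simp: insert_commute)
  have "f \<noteq> c"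
  proof
    assume "f = c"
    then show False using u[OF q(4,5), of a] af q(9) by auto
  qed
  moreover have "f \<noteq> d"
  proof
    assume "f = d"
    then show False using u[OF q(6,7), of a] af q(9) by auto
  qed
  ultimately have "path5 E f a b c d"
    using f(2) \<open>f \<noteq> b\<close> af q by (simp add: path5_def)
  then show ?thesis ..
qed

text \<open>Shifting a path twice puts \<open>b\<close> and then \<open>a\<close> in the middle;
  shifting its reversal does the same for \<open>d\<close> and \<open>e\<close>.\<close>

lemma card_mids_ge_5:
  assumes v: "valid n E" and "legal n E = {}" and "mids E \<noteq> {}"
  shows "5 \<le> card (mids E)"
proof -
  obtain a b c d e where p: "path5 E a b c d e" using assms(3) by (auto simp: mids_def)
  note shift = path5_shift[OF assms(1,2)]
  have left: "b \<in> mids E \<and> a \<in> mids E" if "path5 E a b c d e" for a b c d e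
    using shift[OF that] shift unfolding mids_def by blast
  have "{a, b, c, d, e} \<subseteq> mids E"
    using left[OF p] left[OF path5_rev[OF p]] p by (auto simp: mids_def)
  moreover have "mids E \<subseteq> {..<n}"
  proof
    fix z assume "z \<in> mids E"
    then obtain w x y u where "path5 E w x z y u" unfolding mids_def by blast
    then have "{z, y} \<in> pairs {..<n}" using path5_edges(5) validD(1)[OF v] by fast
    then show "z \<in> {..<n}" by simp
  qed
  then have "finite (mids E)" using finite_subset by blast
  ultimately have "card {a, b, c, d, e} \<le> card (mids E)" by (metis card_mono)
  then show ?thesis using p by (simp add: path5_def)
qed

lemma path5_mono: "path5 A a b c d e \<Longrightarrow> A \<subseteq> B \<Longrightarrow> path5 B a b c d e"
  by (auto simp: path5_def)

lemma mids_mono: "A \<subseteq> B \<Longrightarrow> mids A \<subseteq> mids B"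
  unfolding mids_def using path5_mono by (intro Collect_mono impI) (elim exE, intro exI)

text \<open>Edges are never removed, so a claimed path on five vertices survives to the end of the
  game, whoever moves, and \<open>card_mids_ge_5\<close> applies there.\<close>

lemma gval_ge_5:
  assumes "valid n E" "mids E \<noteq> {}"
  shows "5 \<le> gval n p E"
  using assms
proof (induction "card (pairs {..<n} - E)" arbitrary: E p rule: less_induct)
  case less
  have *: "5 \<le> gval n q (insert e E)" if e: "e \<in> legal n E" for e q
  proof (rule less.hyps[OF card_unclaimed_less[OF e]])
    show "valid n (insert e E)" using e legal_alt[OF less.prems(1)] by simp
    show "mids (insert e E) \<noteq> {}" using less.prems(2) mids_mono[OF subset_insertI, of E e] by auto
  qed
  show ?case
  proof (cases p)
    case Maxi
    show ?thesis
    proof (cases "legal n E = {}")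
      case True
      then show ?thesis using card_mids_ge_5 gval_terminal less.prems by simp
    next
      case False
      then obtain e where e: "e \<in> legal n E" by auto
      show ?thesis unfolding Maxi by (rule gval_Maxi_ge[OF less.prems(1) e *[OF e]])
    qed
  next
    case Mini
    show ?thesis unfolding Mini
      by (rule gval_Mini_ge[OF less.prems(1)]) (use less.prems in \<open>simp_all add: card_mids_ge_5 *\<close>)
  qed
qed

text \<open>Counterpart of \<open>Mini_strategy\<close> with Mini to move. The invariant may be
  given up once a path on five vertices is claimed, since \<open>gval_ge_5\<close> settles the rest;
  \<open>movable\<close> and the existence of a reply exclude an earlier end of the game.\<close>

lemma Maxi_strategy:
  assumes valid: "\<And>E. good E \<Longrightarrow> valid n E"
    and movable: "\<And>E. good E \<Longrightarrow> legal n E \<noteq> {}"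
    and reply: "\<And>E e. good E \<Longrightarrow> e \<in> legal n E \<Longrightarrow> \<exists>e' \<in> legal n (insert e E).
      good (insert e' (insert e E)) \<or> mids (insert e' (insert e E)) \<noteq> {}"
    and "good E"
  shows "5 \<le> gval n Mini E"
  using \<open>good E\<close>
proof (induction "card (pairs {..<n} - E)" arbitrary: E rule: less_induct)
  case less
  show ?case
  proof (rule gval_Mini_ge)
    fix e assume e: "e \<in> legal n E"
    have v: "valid n (insert e E)" using e legal_alt valid[OF less.prems] by blast
    obtain e' where e': "e' \<in> legal n (insert e E)"
      "good (insert e' (insert e E)) \<or> mids (insert e' (insert e E)) \<noteq> {}"
      using reply[OF less.prems e] by blast
    have v': "valid n (insert e' (insert e E))" using e'(1) legal_alt[OF v] by blast
    have lt: "card (pairs {..<n} - insert e' (insert e E)) < card (pairs {..<n} - E)"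
      using card_unclaimed_less[OF e] card_unclaimed_less[OF e'(1)] by linarith
    have "5 \<le> gval n Mini (insert e' (insert e E))"
      using e'(2) less.hyps[OF lt] gval_ge_5[OF v'] by (elim disjE)
    then show "5 \<le> gval n Maxi (insert e E)" by (rule gval_Maxi_ge[OF v e'(1)])
  qed (use less.prems valid movable in auto)
qed

section \<open>Matchings\<close>

definition matching :: "'a set set \<Rightarrow> bool" where
  "matching M \<longleftrightarrow> (\<forall>v. deg M v \<le> 1)"

lemma matching_unique:
  assumes "matching M" "finite M" "{v, a} \<in> M" "{v, b} \<in> M"
  shows "a = b"
proof (rule ccontr)
  assume "a \<noteq> b"
  with deg_ge_2[OF assms(2-4)] have "2 \<le> deg M v" .
  moreover have "deg M v \<le> 1" using assms(1) by (simp add: matching_def)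
  ultimately show False by simp
qed

lemma deg_1_obtain:
  assumes "E \<subseteq> pairs V" "deg E v = 1"
  obtains w where "{v, w} \<in> E" "w \<noteq> v"
proof -
  have "{s \<in> E. v \<in> s} \<noteq> {}" using assms(2) by (metis card.empty deg_def zero_neq_one)
  then obtain s where "s \<in> E" "v \<in> s" by auto
  then show thesis using pairsD[of s V v] assms(1) that by blast
qed

section \<open>The lower bound\<close>

text \<open>In a matching, \<open>deg E v\<close> plus the indicator of \<open>deg E v = 0\<close>
  is 1 at each vertex; the sum is evaluated by \<open>handshake\<close>.\<close>

lemma card_isolated:
  assumes "valid n E" "matching E"
  shows "card {v \<in> {..<n}. deg E v = 0} + 2 * card E = n"
proof -
  have "deg E v + (if deg E v = 0 then 1 else 0) = 1" for v
    using assms(2)[unfolded matching_def, rule_format, of v] by (cases "deg E v") auto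
  then have "(\<Sum>v<n. deg E v + (if deg E v = 0 then 1 else 0)) = (\<Sum>v<n. 1)" by (simp only:)
  then show ?thesis
    using handshake[OF validD(1)[OF assms(1)]] by (simp add: sum.distrib sum.If_cases Int_def)
qed

text \<open>Parity is what Max maintains: by \<open>card_isolated\<close>, an even number of edges
  makes the number of isolated vertices congruent to \<open>n\<close> modulo 4.\<close>

definition even_matching :: "nat \<Rightarrow> nat set set \<Rightarrow> bool" where
  "even_matching n E \<longleftrightarrow> valid n E \<and> matching E \<and> even (card E)"

text \<open>Vertex 0 is matched to at most one of 1 and 2, and all degrees allow one more
  edge.\<close>

lemma even_matching_movable:
  assumes "even_matching n E" "5 \<le> n"
  shows "legal n E \<noteq> {}"
proof -
  have v: "valid n E" and m: "matching E" using assms by (auto simp: even_matching_def)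
  obtain y :: nat where "y = 1 \<or> y = 2" "{0, y} \<notin> E"
    using matching_unique[OF m validD(3)[OF v], of 0 1 2] by fastforce
  then have "{0, y} \<in> legal n E"
    using legal_doubleton_iff[OF v, of 0 y] m assms(2) by (auto simp: matching_def)
  then show ?thesis by auto
qed

text \<open>Max answers a new isolated edge by another one; any other move of Mini joins a claimed edge to
  something, and then Max completes a path on five vertices.\<close>

lemma even_matching_reply:
  assumes em: "even_matching n E" and n: "5 \<le> n" "n mod 4 \<le> 1" and e: "e \<in> legal n E"
  shows "\<exists>e' \<in> legal n (insert e E).
    even_matching n (insert e' (insert e E)) \<or> mids (insert e' (insert e E)) \<noteq> {}"
proof -
  have v: "valid n E" and m: "matching E" and ev: "even (card E)"
    using em by (auto simp: even_matching_def)
  note fin = validD(3)[OF v]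
  have m1: "deg E w \<le> 1" for w using m by (simp add: matching_def)
  have eE: "e \<notin> E" and v1: "valid n (insert e E)" using e legal_alt[OF v] by auto
  note deg1 = deg_insert[OF fin eE]
  show ?thesis
  proof (cases "\<exists>y \<in> e. deg E y = 1")
    case False
    obtain x y where xy: "e = {x, y}" "x \<noteq> y" "x < n" "y < n" using legalE[OF e v] by metis
    let ?I = "{v \<in> {..<n}. deg E v = 0}"
    have d0: "deg E x = 0" "deg E y = 0" using False m1[of x] m1[of y] xy(1) by auto
    then have "card {x, y} \<le> card ?I" using xy by (intro card_mono) auto
    then have "2 \<le> card ?I" using xy(2) by simp
    moreover have "card ?I + 2 * card E = n" by (rule card_isolated[OF v m])
    \<comment> \<open>The number of isolated vertices is 0 or 1 modulo 4 and at least two, hence at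
      least four: two remain for Max.\<close>
    ultimately have "4 \<le> card ?I" using ev n(2) by presburger
    then have "2 \<le> card (?I - {x, y})" using d0 xy by (subst card_Diff_subset) auto
    then obtain S where "S \<subseteq> ?I - {x, y}" "card S = 2" by (meson obtain_subset_with_card_n)
    then obtain u w where uw: "u \<noteq> w" "u \<in> ?I - {x, y}" "w \<in> ?I - {x, y}"
      by (auto simp: card_2_iff)
    have "u \<notin> \<Union>E" using uw deg_eq_0_iff[OF fin, of u] by simp
    then have new: "{u, w} \<notin> insert e E" using uw xy by (auto simp: doubleton_eq_iff)
    have leg: "{u, w} \<in> legal n (insert e E)"
      unfolding legal_doubleton_iff[OF v1] using uw new xy deg1[of u] deg1[of w] by auto
    have "matching (insert {u, w} (insert e E))"
      unfolding matching_def using deg_insert[OF _ new] deg1 fin d0 uw m1 xy by auto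
    moreover have "valid n (insert {u, w} (insert e E))" using leg legal_alt[OF v1] by simp
    moreover have "even (card (insert {u, w} (insert e E)))" using fin new eE ev by simp
    ultimately show ?thesis using leg unfolding even_matching_def by blast
  next
    case True
    then obtain x y where xy: "e = {x, y}" "x \<noteq> y" "x < n" "y < n" and dy: "deg E y = 1"
    proof -
      obtain a b where ab: "e = {a, b}" "a \<noteq> b" "a < n" "b < n" using legalE[OF e v] by metis
      have "e = {b, a}" using ab by auto
      then show thesis using that[of a b] that[of b a] ab True by auto
    qed
    obtain z where z: "{y, z} \<in> E" "z \<noteq> y" using deg_1_obtain[OF validD(1)[OF v] dy] .
    have zx: "z \<noteq> x" using z xy eE by (auto simp: insert_commute)
    have zn: "z < n" using z validD(1)[OF v] by auto
    have zy: "{z, y} \<in> E" using z by (simp add: insert_commute)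
    \<comment> \<open>\<open>z\<close> is the partner of \<open>y\<close>, and Mini has just joined
      \<open>y\<close> to \<open>x\<close>. In all remaining cases Max continues at
      \<open>z\<close>, with a move \<open>{z, u}\<close>.\<close>
    have win: "\<exists>e' \<in> legal n (insert e E).
        even_matching n (insert e' (insert e E)) \<or> mids (insert e' (insert e E)) \<noteq> {}"
      if u: "u < n" "u \<notin> {x, y, z}"
        and mid: "mids (insert {z, u} (insert e E)) \<noteq> {}" for u
    proof -
      have "{z, u} \<notin> E" using matching_unique[OF m fin zy, of u] u by auto
      then have "{z, u} \<in> legal n (insert e E)"
        unfolding legal_doubleton_iff[OF v1]
        using u zx z zn xy deg1[of z] deg1[of u] m1 by (auto simp: doubleton_eq_iff)
      with mid show ?thesis by blast
    qed
    show ?thesis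
    proof (cases "deg E x = 0")
      case True
      \<comment> \<open>Evenness supplies a second edge \<open>{u, w}\<close>; linking
        \<open>z\<close> to \<open>u\<close> completes the path \<open>x y z u w\<close>.\<close>
      have "E \<noteq> {{y, z}}" using ev by auto
      then obtain f where f: "f \<in> E" "f \<noteq> {y, z}" using z by blast
      then have "f \<in> pairs {..<n}" using validD(1)[OF v] by blast
      then obtain u w where uw: "f = {u, w}" "u \<noteq> w" "u < n"
        by (auto simp: pairs_def card_2_iff)
      have "x \<notin> \<Union>E" using True deg_eq_0_iff[OF fin] by simp
      then have "x \<noteq> u" "x \<noteq> w" using f uw by auto
      have g: "{u, w} \<in> E" "{w, u} \<in> E" "{u, w} \<noteq> {y, z}" "{w, u} \<noteq> {y, z}"
        using f uw by (simp_all add: insert_commute)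
      have "u \<noteq> y" using matching_unique[OF m fin z(1), of w] g by blast
      moreover have "w \<noteq> y" using matching_unique[OF m fin z(1), of u] g by blast
      moreover have "u \<noteq> z" using matching_unique[OF m fin zy, of w] g by blast
      moreover have "w \<noteq> z" using matching_unique[OF m fin zy, of u] g by blast
      ultimately have "path5 (insert {z, u} (insert e E)) x y z u w" "u \<notin> {x, y, z}"
        using \<open>x \<noteq> u\<close> \<open>x \<noteq> w\<close> g(1) uw(2) z zx xy(1,2) by (simp_all add: path5_def)
      then show ?thesis using win[of u] uw(3) unfolding mids_def by blast
    next
      case False
      then have "deg E x = 1" using m1[of x] by linarith
      then obtain w where w: "{x, w} \<in> E" "w \<noteq> x" using deg_1_obtain[OF validD(1)[OF v]] by metis
      have wx: "{w, x} \<in> E" using w by (simp add: insert_commute)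
      have "w \<noteq> y" using w eE xy by auto
      have "w \<noteq> z" using matching_unique[OF m fin zy, of x] wx xy by auto
      \<comment> \<open>\<open>w x y z\<close> is already a path, and \<open>5 \<le> n\<close>
        leaves a fifth vertex \<open>u\<close> to attach at \<open>z\<close>.\<close>
      have "card {w, x, y, z} \<le> 4" by (simp add: card_insert_if)
      then have "\<not> {..<n} \<subseteq> {w, x, y, z}"
        using card_mono[of "{w, x, y, z}" "{..<n}"] n(1) by auto
      then obtain u where u: "u < n" "u \<notin> {w, x, y, z}" by auto
      then have "path5 (insert {z, u} (insert e E)) w x y z u"
        using wx w(2) z zx xy(1,2) \<open>w \<noteq> y\<close> \<open>w \<noteq> z\<close> by (simp add: path5_def) blast
      then show ?thesis using win[of u] u unfolding mids_def by blast
    qed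
  qed
qed

lemma valid_empty [simp]: "valid n {}"
  by (simp add: valid_def deg_def)

lemma s2_ge_5:
  assumes "5 \<le> n" "n mod 4 \<le> 1"
  shows "5 \<le> s2 n (path_graph 5) (star_graph 4)"
proof -
  have "even_matching n {}" by (simp add: even_matching_def matching_def deg_def)
  then show ?thesis
    unfolding s2_def using even_matching_movable even_matching_reply assms
    by (intro Maxi_strategy[where good = "even_matching n"]) (auto simp: even_matching_def)
qed

section \<open>Open paths and closed parts\<close>

abbreviation vdisj :: "'a set set \<Rightarrow> 'a set set \<Rightarrow> bool" where
  "vdisj A B \<equiv> \<Union>A \<inter> \<Union>B = {}"

text \<open>For finite sets of pairs these are the disjoint unions of cycles, whose vertices admit
  no further edge.\<close>

definition closed :: "'a set set \<Rightarrow> bool" where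
  "closed C \<longleftrightarrow> (\<forall>v\<in>\<Union>C. deg C v = 2)"

text \<open>Connectedness is not required: only the end degrees and the number of vertices matter.\<close>

definition open_path :: "'a set set \<Rightarrow> 'a \<Rightarrow> 'a \<Rightarrow> bool" where
  "open_path P p q \<longleftrightarrow> p \<noteq> q \<and> deg P p = 1 \<and> deg P q = 1 \<and>
     (\<forall>v \<in> \<Union>P. v \<noteq> p \<longrightarrow> v \<noteq> q \<longrightarrow> deg P v = 2)"

lemma open_path_sym: "open_path P p q \<Longrightarrow> open_path P q p"
  by (auto simp: open_path_def)

lemma open_path_ends: "open_path P p q \<Longrightarrow> p \<in> \<Union>P \<and> q \<in> \<Union>P"
  using deg_eq_0[of p P] deg_eq_0[of q P] by (force simp: open_path_def)

lemma open_path_edge: "x \<noteq> y \<Longrightarrow> open_path {{x, y}} x y"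
  using deg_insert[of "{}" "{x, y}"] by (auto simp: open_path_def deg_eq_0)

lemma closed_empty [simp]: "closed {}" by (simp add: closed_def)

lemma closed_Un: "closed A \<Longrightarrow> closed B \<Longrightarrow> vdisj A B \<Longrightarrow> closed (A \<union> B)"
  unfolding closed_def by (auto simp: deg_Un)

text \<open>Only the two ends change degree, from one to two. The premise
  \<open>{p, q} \<notin> P\<close> excludes the single edge, which cannot be closed.\<close>

lemma closed_insert_ends:
  assumes "finite P" "open_path P p q" "{p, q} \<notin> P"
  shows "closed (insert {p, q} P)" "\<Union>(insert {p, q} P) = \<Union>P"
  using assms(2) open_path_ends[OF assms(2)]
  by (auto simp: closed_def open_path_def deg_insert[OF assms(1,3)])

text \<open>Only \<open>q\<close> and \<open>r\<close> gain an edge, each passing from degree one to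
  two; disjointness keeps all other degrees.\<close>

lemma open_path_join:
  assumes "finite P" "finite Q" "open_path P p q" "open_path Q r s" "vdisj P Q"
  shows "open_path (insert {q, r} (P \<union> Q)) p s"
proof -
  have e: "p \<in> \<Union>P" "q \<in> \<Union>P" "r \<in> \<Union>Q" "s \<in> \<Union>Q"
    using open_path_ends[OF assms(3)] open_path_ends[OF assms(4)] by blast+
  then have n: "p \<notin> \<Union>Q" "q \<notin> \<Union>Q" "r \<notin> \<Union>P" "s \<notin> \<Union>P" using assms(5) by blast+
  have "{q, r} \<notin> P \<union> Q" using n by blast
  then have d: "deg (insert {q, r} (P \<union> Q)) v =
      (if v \<in> {q, r} then Suc (deg (P \<union> Q) v) else deg (P \<union> Q) v)" for v
    using assms(1,2) by (simp add: deg_insert)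
  have dP: "deg (P \<union> Q) v = deg P v" if "v \<in> \<Union>P" for v
    using that deg_Un[OF assms(5)] by simp
  have dQ: "deg (P \<union> Q) v = deg Q v" if "v \<in> \<Union>Q" for v
  proof -
    have "v \<notin> \<Union>P" using that assms(5) by blast
    then show ?thesis using deg_Un[OF assms(5), of v] by simp
  qed
  have P: "p \<noteq> q" "deg P p = 1" "deg P q = 1"
      "\<And>v. v \<in> \<Union>P \<Longrightarrow> v \<noteq> p \<Longrightarrow> v \<noteq> q \<Longrightarrow> deg P v = 2"
    using assms(3) by (auto simp: open_path_def)
  have Q: "r \<noteq> s" "deg Q r = 1" "deg Q s = 1"
      "\<And>v. v \<in> \<Union>Q \<Longrightarrow> v \<noteq> r \<Longrightarrow> v \<noteq> s \<Longrightarrow> deg Q v = 2"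
    using assms(4) by (auto simp: open_path_def)
  have ne: "p \<noteq> s" "p \<noteq> r" "q \<noteq> s" "q \<noteq> r" using e n by blast+
  show ?thesis
    unfolding open_path_def
  proof (intro conjI ballI impI)
    show "p \<noteq> s" by (rule ne)
    show "deg (insert {q, r} (P \<union> Q)) p = 1" using d[of p] dP[OF e(1)] P ne by simp
    show "deg (insert {q, r} (P \<union> Q)) s = 1" using d[of s] dQ[OF e(4)] Q ne by simp
    fix v assume v: "v \<in> \<Union>(insert {q, r} (P \<union> Q))" "v \<noteq> p" "v \<noteq> s"
    then have "v \<in> \<Union>P \<or> v \<in> \<Union>Q" using e by auto
    then show "deg (insert {q, r} (P \<union> Q)) v = 2"
    proof
      assume vP: "v \<in> \<Union>P"
      then have "v \<noteq> r" using n by blast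
      then show ?thesis using d[of v] dP[OF vP] P(3) P(4)[OF vP v(2)] by (cases "v = q") simp_all
    next
      assume vQ: "v \<in> \<Union>Q"
      then have "v \<noteq> q" using n by blast
      then show ?thesis using d[of v] dQ[OF vQ] Q(2) Q(4)[OF vQ _ v(3)] by (cases "v = r") simp_all
    qed
  qed
qed

text \<open>A single vertex does not count as an \<open>open_path\<close>, so attaching one is not
  an instance of \<open>open_path_join\<close>.\<close>

lemma open_path_extend:
  assumes "finite P" "open_path P p q" "x \<notin> \<Union>P"
  shows "open_path (insert {x, p} P) x q"
proof -
  note e = open_path_ends[OF assms(2)]
  have "{x, p} \<notin> P" using assms(3) by blast
  then have d: "deg (insert {x, p} P) v = (if v \<in> {x, p} then Suc (deg P v) else deg P v)" for v
    by (rule deg_insert[OF assms(1)])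
  have "x \<noteq> p" "x \<noteq> q" using e assms(3) by blast+
  then show ?thesis
    using assms(2) d deg_eq_0[OF assms(3)] by (auto simp: open_path_def)
qed

text \<open>Both ends lose their only edge and become isolated, so the edge splits off as a part of
  its own.\<close>

lemma matching_remove:
  assumes "matching M" "finite M" "{x, w} \<in> M"
  shows "matching (M - {{x, w}})" "vdisj (M - {{x, w}}) {{x, w}}"
    "M = (M - {{x, w}}) \<union> {{x, w}}"
proof -
  let ?M = "M - {{x, w}}"
  have M: "M = insert {x, w} ?M" using assms(3) by auto
  have d: "deg M v = (if v \<in> {x, w} then Suc (deg ?M v) else deg ?M v)" for v
    using deg_insert[of ?M "{x, w}" v] M assms(2) by simp
  have m: "deg M v \<le> 1" for v using assms(1) by (simp add: matching_def)
  have "deg ?M v \<le> 1" for v using d[of v] m[of v] by (cases "v \<in> {x, w}") auto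
  then show "matching ?M" by (simp add: matching_def)
  have "deg ?M v = 0" if "v \<in> {x, w}" for v using that d[of v] m[of v] by simp
  then have "v \<notin> \<Union>?M" if "v \<in> {x, w}" for v
    using that deg_eq_0_iff[of ?M v] assms(2) by simp
  then show "vdisj ?M {{x, w}}" by blast
  show "M = ?M \<union> {{x, w}}" using M by simp
qed

section \<open>Middle vertices of disjoint unions, small parts and matchings\<close>

lemma mids_subset: "mids A \<subseteq> \<Union>A"
proof
  fix c assume "c \<in> mids A"
  then obtain a b d e where p: "path5 A a b c d e" unfolding mids_def by blast
  show "c \<in> \<Union>A" using path5_edges(3)[OF p] by blast
qed

text \<open>Consecutive edges of a path share a vertex, so a path cannot pass between
  vertex-disjoint parts: its first edge decides where it lies.\<close>

lemma mids_Un: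
  assumes "vdisj A B"
  shows "mids (A \<union> B) = mids A \<union> mids B"
proof
  have step: "{y, z} \<in> A" if "{x, y} \<in> A" "{y, z} \<in> A \<union> B" "vdisj A B" for A B :: "'a set set" and x y z
    using that by blast
  have all_in: "path5 A a b c d e" if "path5 (A \<union> B) a b c d e" "{a, b} \<in> A" "vdisj A B"
    for A B :: "'a set set" and a b c d e
  proof -
    note p = path5_edges[OF that(1)]
    have bc: "{b, c} \<in> A" by (rule step[OF that(2) p(3) that(3)])
    have cd: "{c, d} \<in> A" by (rule step[OF bc p(5) that(3)])
    have "{d, e} \<in> A" by (rule step[OF cd p(7) that(3)])
    with bc cd that(2) p(9) show ?thesis by (simp add: path5_def)
  qed
  show "mids (A \<union> B) \<subseteq> mids A \<union> mids B"
  proof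
    fix c assume "c \<in> mids (A \<union> B)"
    then obtain a b d e where p: "path5 (A \<union> B) a b c d e" unfolding mids_def by blast
    have "{a, b} \<in> A \<or> {a, b} \<in> B" using path5_edges(1)[OF p] by blast
    then have "path5 A a b c d e \<or> path5 B a b c d e"
      using all_in[OF p _ assms] all_in[of B A a b c d e] p assms by (auto simp: Un_commute Int_commute)
    then show "c \<in> mids A \<union> mids B" unfolding mids_def by blast
  qed
  show "mids A \<union> mids B \<subseteq> mids (A \<union> B)"
    using mids_mono[of A "A \<union> B"] mids_mono[of B "A \<union> B"] by blast
qed

lemma mids_small:
  assumes "finite (\<Union>A)" "card (\<Union>A) \<le> 4"
  shows "mids A = {}"
proof (rule ccontr)
  assume "mids A \<noteq> {}"
  then obtain a b c d e where p: "path5 A a b c d e" by (auto simp: mids_def)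
  have "{a, b, c, d, e} \<subseteq> \<Union>A"
    using path5_edges(1,3,5,7)[OF p] by blast
  then have "card {a, b, c, d, e} \<le> card (\<Union>A)" using assms(1) by (rule card_mono[rotated])
  then show False using p assms(2) by (simp add: path5_def)
qed

lemma mids_matching:
  assumes "matching M" "finite M"
  shows "mids M = {}"
proof (rule ccontr)
  assume "mids M \<noteq> {}"
  then obtain a b c d e where p: "path5 M a b c d e" by (auto simp: mids_def)
  have "b = d" using path5_edges(4,5)[OF p] by (rule matching_unique[OF assms])
  then show False using p by (simp add: path5_def)
qed

section \<open>The upper bound\<close>

text \<open>The remainder \<open>R\<close> is the one path on three or four vertices that Mini may be forced to
  create once no isolated vertices are left.\<close>

definition shape :: "nat \<Rightarrow> nat set set \<Rightarrow> nat set set \<Rightarrow> nat set set \<Rightarrow> bool" where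
  "shape n C M R \<longleftrightarrow> valid n (C \<union> M \<union> R) \<and> vdisj C M \<and> vdisj C R \<and> vdisj M R \<and>
     closed C \<and> matching M \<and>
     (R = {} \<or> card (\<Union>R) \<le> 4 \<and> (\<exists>p q. open_path R p q)) \<and>
     card (mids C) \<le> 6 \<and> (mids C = {} \<or> R = {}) \<and>
     (mids C = {} \<and> R = {} \<or> \<Union>C \<union> \<Union>M \<union> \<Union>R = {..<n})"

text \<open>The invariant for positions with Max to move: \<open>C\<close> holds the finished cycles
  and \<open>M\<close> the single edges. By the last clauses of \<open>shape\<close>, a scoring
  \<open>C\<close> and a nonempty \<open>R\<close> exclude each other, and either requires that no
  vertex is isolated.\<close>

definition tame :: "nat \<Rightarrow> nat set set \<Rightarrow> bool" where
  "tame n E \<longleftrightarrow> (\<exists>C M R. E = C \<union> M \<union> R \<and> shape n C M R)"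

text \<open>Applied after a move of Max, this is the \<open>reply\<close> obligation of
  \<open>Mini_strategy\<close> for \<open>k = 6\<close> and \<open>good = tame n\<close>.\<close>

definition repliable :: "nat \<Rightarrow> nat set set \<Rightarrow> bool" where
  "repliable n E \<longleftrightarrow> (if legal n E = {} then card (mids E) \<le> 6
     else \<exists>e \<in> legal n E. tame n (insert e E))"

lemma repliableI: "e \<in> legal n E \<Longrightarrow> tame n (insert e E) \<Longrightarrow> repliable n E"
  by (auto simp: repliable_def)

lemma finite_Union_pairs: "E \<subseteq> pairs {..<n::nat} \<Longrightarrow> finite (\<Union>E)"
  by (rule finite_subset[of _ "{..<n}"]) (auto simp: pairs_def)

text \<open>The parts are vertex-disjoint, and neither a matching nor a part on at most four
  vertices contains a path on five vertices, so only \<open>C\<close> scores.\<close>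

lemma tame_card_mids:
  assumes "tame n E"
  shows "card (mids E) \<le> 6"
proof -
  obtain C M R where E: "E = C \<union> M \<union> R" and s: "shape n C M R"
    using assms by (auto simp: tame_def)
  have v: "valid n (C \<union> M \<union> R)" using s by (simp add: shape_def)
  have "mids R = {}"
  proof (cases "R = {}")
    case False
    have "finite (\<Union>R)" using finite_Union_pairs[of R n] validD(1)[OF v] by simp
    then show ?thesis using mids_small[of R] False s by (simp add: shape_def)
  qed (auto simp: mids_def path5_def)
  moreover have "mids M = {}"
    using mids_matching[of M] s validD(3)[OF v] by (simp add: shape_def)
  moreover have "vdisj C M" "vdisj (C \<union> M) R" using s by (auto simp: shape_def)
  ultimately have "mids E = mids C" unfolding E by (simp add: mids_Un)
  then show ?thesis using s by (simp add: shape_def)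
qed

text \<open>\<open>P\<close> is the open path that the last move of Max produced; Mini claims
  \<open>{p, q}\<close> and so moves \<open>P\<close> into \<open>C\<close>. If \<open>P\<close> has
  more than four vertices, the new cycle may score, and \<open>big\<close> asks that it be the only
  scoring part and that no vertex be isolated.\<close>

lemma repliable_close:
  assumes v: "valid n (C \<union> M \<union> R \<union> P)"
    and dis: "vdisj C M" "vdisj C R" "vdisj M R" "vdisj C P" "vdisj M P" "vdisj R P"
    and C: "closed C" and M: "matching M"
    and R: "R = {} \<or> card (\<Union>R) \<le> 4 \<and> (\<exists>p q. open_path R p q)"
    and P: "open_path P p q" "{p, q} \<notin> P" "card (\<Union>P) \<le> 6"
    and mids: "card (mids C) \<le> 6" "mids C = {} \<or> R = {}"
    and cover: "mids C = {} \<and> R = {} \<or> \<Union>C \<union> \<Union>M \<union> \<Union>R \<union> \<Union>P = {..<n}"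
    and big: "4 < card (\<Union>P) \<Longrightarrow>
      mids C = {} \<and> R = {} \<and> \<Union>C \<union> \<Union>M \<union> \<Union>R \<union> \<Union>P = {..<n}"
  shows "repliable n (C \<union> M \<union> R \<union> P)"
proof (rule repliableI)
  let ?E = "C \<union> M \<union> R \<union> P" and ?P = "insert {p, q} P"
  have fin: "finite P" using validD(3)[OF v] by simp
  have e: "p \<in> \<Union>P" "q \<in> \<Union>P" using open_path_ends[OF P(1)] by auto
  have "vdisj (C \<union> M \<union> R) P" using dis by auto
  moreover from this have "p \<notin> \<Union>(C \<union> M \<union> R)" "q \<notin> \<Union>(C \<union> M \<union> R)" using e by blast+
  ultimately have "deg ?E p = 1" "deg ?E q = 1"
    using deg_Un[of "C \<union> M \<union> R" P] P(1) by (simp_all add: open_path_def)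
  moreover have "{p, q} \<notin> ?E" using P(2) \<open>p \<notin> \<Union>(C \<union> M \<union> R)\<close> by blast
  moreover have "p < n" "q < n" using e validD(1)[OF v] by (auto simp: pairs_def)
  moreover have "p \<noteq> q" using P(1) by (simp add: open_path_def)
  ultimately show leg: "{p, q} \<in> legal n ?E" using legal_doubleton_iff[OF v] by simp
  then have v': "valid n (insert {p, q} ?E)" using legal_alt[OF v] by simp
  note cl = closed_insert_ends[OF fin P(1,2)]
  have finP: "finite (\<Union>P)" using finite_Union_pairs[of P n] validD(1)[OF v] by simp
  have CP: "vdisj C ?P" using dis(4) cl(2) by simp
  have m: "mids (C \<union> ?P) = mids C \<union> mids ?P" by (rule mids_Un[OF CP])
  have m': "card (mids (C \<union> ?P)) \<le> 6 \<and> (mids (C \<union> ?P) = {} \<or> R = {}) \<and>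
      (mids (C \<union> ?P) = {} \<and> R = {} \<or> \<Union>C \<union> \<Union>M \<union> \<Union>R \<union> \<Union>P = {..<n})"
  proof (cases "card (\<Union>P) \<le> 4")
    case True
    then have "mids ?P = {}" using mids_small[of ?P] cl(2) finP by simp
    then show ?thesis using m mids cover by simp
  next
    case False
    then have b: "mids C = {} \<and> R = {} \<and> \<Union>C \<union> \<Union>M \<union> \<Union>R \<union> \<Union>P = {..<n}"
      using False by (intro big) simp
    \<comment> \<open>Middle vertices lie on the cycle itself, which has at most six vertices; hence
      the constant 6.\<close>
    have "card (mids ?P) \<le> card (\<Union>P)"
      using mids_subset[of ?P] cl(2) finP by (intro card_mono) simp_all
    then have "card (mids (C \<union> ?P)) \<le> 6" using m b P(3) by simp
    with b show ?thesis by blast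
  qed
  have "insert {p, q} ?E = (C \<union> ?P) \<union> M \<union> R" by auto
  moreover have "shape n (C \<union> ?P) M R"
    unfolding shape_def
  proof (intro conjI)
    show "valid n ((C \<union> ?P) \<union> M \<union> R)" using v' calculation by simp
    have U: "\<Union>(C \<union> ?P) = \<Union>C \<union> \<Union>P" unfolding Union_Un_distrib cl(2) ..
    show "vdisj (C \<union> ?P) M" "vdisj (C \<union> ?P) R" unfolding U using dis by auto
    show "closed (C \<union> ?P)" by (rule closed_Un[OF C cl(1) CP])
    show "mids (C \<union> ?P) = {} \<and> R = {} \<or> \<Union>(C \<union> ?P) \<union> \<Union>M \<union> \<Union>R = {..<n}"
      unfolding U using m' by blast
  qed (use m' dis M R in auto)
  ultimately show "tame n (insert {p, q} ?E)" unfolding tame_def by blast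
qed

text \<open>Here \<open>E\<close> is the position before the move of Mini, and it is her own move
  \<open>e\<close> that leaves the open path \<open>R\<close>.\<close>

lemma tame_remainder:
  assumes v: "valid n E" and leg: "e \<in> legal n E" and E: "insert e E = C \<union> M \<union> R"
    and "vdisj C M" "vdisj C R" "vdisj M R" "closed C" "matching M" "mids C = {}"
    and "card (\<Union>R) \<le> 4" "open_path R p q" and "\<Union>C \<union> \<Union>M \<union> \<Union>R = {..<n}"
  shows "repliable n E"
proof (rule repliableI[OF leg])
  have "valid n (C \<union> M \<union> R)" using leg legal_alt[OF v] E by simp
  then have "shape n C M R" using assms unfolding shape_def by (auto simp del: Union_iff)
  then show "tame n (insert e E)" unfolding tame_def E by blast
qed

section \<open>Moves of Mini when there is no path to close\<close>

lemma matching_edge: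
  assumes "M \<subseteq> pairs V" "x \<in> \<Union>M"
  obtains w where "{x, w} \<in> M" "w \<noteq> x"
proof -
  obtain s where "s \<in> M" "x \<in> s" using assms(2) by auto
  then show thesis using pairsD[of s V x] assms(1) that by blast
qed

text \<open>Joining two single edges gives the path \<open>w x y z\<close>, which can still be
  closed to a four-cycle. Serves both a move of Max that Mini closes and a move of Mini that leaves
  a remainder.\<close>

lemma matching_two_edges:
  assumes "matching M" "finite M" "{x, w} \<in> M" "{y, z} \<in> M" "{x, y} \<notin> M" "x \<noteq> y" "w \<noteq> x" "z \<noteq> y"
  defines "N \<equiv> M - {{x, w}} - {{y, z}}" and "P \<equiv> insert {x, y} ({{x, w}} \<union> {{y, z}})"
  shows "matching N" "vdisj N P" "insert {x, y} M = N \<union> P" "open_path P w z"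
    "\<Union>P = {w, x, y, z}" "\<Union>M = \<Union>N \<union> \<Union>P" "{w, z} \<notin> P"
proof -
  note r1 = matching_remove[OF assms(1-3)]
  have "{y, z} \<noteq> {x, w}" using assms(4-6) by (auto simp: doubleton_eq_iff insert_commute)
  then have yz: "{y, z} \<in> M - {{x, w}}" using assms(4) by simp
  note r2 = matching_remove[OF r1(1) _ yz]
  have fin: "finite (M - {{x, w}})" using assms(2) by simp
  have dis: "vdisj {{x, w}} {{y, z}}" using r1(2) yz by blast
  show "matching N" unfolding N_def by (rule r2(1)[OF fin])
  have "vdisj N {{y, z}}" unfolding N_def by (rule r2(2)[OF fin])
  moreover have "vdisj N {{x, w}}" using r1(2) unfolding N_def by blast
  ultimately show "vdisj N P" unfolding P_def by blast
  show "insert {x, y} M = N \<union> P" using assms(3,4) unfolding N_def P_def by blast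
  have "open_path {{x, w}} w x" "open_path {{y, z}} y z"
    using open_path_edge[of w x] open_path_edge[of y z] assms by (simp_all add: insert_commute)
  then show "open_path P w z" unfolding P_def by (intro open_path_join dis) simp_all
  show U: "\<Union>P = {w, x, y, z}" unfolding P_def by auto
  have "\<Union>M = \<Union>N \<union> {w, x, y, z}" using assms(3,4) unfolding N_def by blast
  then show "\<Union>M = \<Union>N \<union> \<Union>P" using U by simp
  have "{x, w} \<inter> {y, z} = {}" using dis by simp
  then show "{w, z} \<notin> P" using assms(6-8) unfolding P_def by (auto simp: doubleton_eq_iff)
qed

lemma card_four: "card {w, x, y, z} \<le> 4"
  by (simp add: card_insert_if)

lemma legal_not_in_closed:
  assumes "closed C" "vdisj C D" "deg (C \<union> D) x \<le> 1"
  shows "x \<notin> \<Union>C"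
proof
  assume x: "x \<in> \<Union>C"
  then have "deg (C \<union> D) x = deg C x" by (simp only: deg_Un[OF assms(2)] if_True)
  moreover have "deg C x = 2" using assms(1) x unfolding closed_def by (rule bspec)
  ultimately show False using assms(3) by simp
qed

text \<open>Without isolated vertices every vertex outside \<open>C\<close> lies on a single edge,
  so any legal move joins two single edges, and the result is a remainder on four vertices. If no
  move is left, nothing scores.\<close>

lemma repliable_covered:
  assumes v: "valid n (C \<union> M)" and dis: "vdisj C M" and C: "closed C" "mids C = {}"
    and M: "matching M" and cover: "\<Union>C \<union> \<Union>M = {..<n}"
  shows "repliable n (C \<union> M)"
proof (cases "legal n (C \<union> M) = {}")
  case True
  have "mids (C \<union> M) = {}"
    using mids_Un[OF dis] C(2) mids_matching[OF M] validD(3)[OF v] by simp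
  then show ?thesis using True by (simp add: repliable_def)
next
  case False
  then obtain e where e: "e \<in> legal n (C \<union> M)" by auto
  obtain x y where xy: "e = {x, y}" "x \<noteq> y" "x < n" "y < n" "{x, y} \<notin> C \<union> M"
    "deg (C \<union> M) x \<le> 1" "deg (C \<union> M) y \<le> 1" using legalE[OF e v] by metis
  have "x \<notin> \<Union>C" "y \<notin> \<Union>C" using legal_not_in_closed[OF C(1) dis] xy by auto
  then have "x \<in> \<Union>M" "y \<in> \<Union>M" using cover xy by blast+
  have Mp: "M \<subseteq> pairs {..<n}" and fin: "finite M" using validD(1,3)[OF v] by auto
  obtain w where w: "{x, w} \<in> M" "w \<noteq> x" using matching_edge[OF Mp \<open>x \<in> \<Union>M\<close>] .
  obtain z where z: "{y, z} \<in> M" "z \<noteq> y" using matching_edge[OF Mp \<open>y \<in> \<Union>M\<close>] .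
  have "{x, y} \<notin> M" using xy by simp
  note t = matching_two_edges[OF M fin w(1) z(1) this xy(2) w(2) z(2)]
  let ?N = "M - {{x, w}} - {{y, z}}" and ?P = "insert {x, y} ({{x, w}} \<union> {{y, z}})"
  show ?thesis
  proof (rule tame_remainder[OF v e _ _ _ t(2) C(1) t(1) C(2) _ t(4)])
    have "insert e (C \<union> M) = C \<union> insert {x, y} M" using xy(1) by simp
    then show "insert e (C \<union> M) = C \<union> ?N \<union> ?P" unfolding t(3) by (simp only: Un_assoc)
    show "vdisj C ?N" "vdisj C ?P" using dis t(6) by auto
    show "card (\<Union>?P) \<le> 4" unfolding t(5) by (rule card_four)
    show "\<Union>C \<union> \<Union>?N \<union> \<Union>?P = {..<n}" using cover t(6) by auto
  qed
qed

text \<open>Mini prefers to join two isolated vertices, which only enlarges \<open>M\<close>; the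
  edge \<open>{x, y}\<close> is needed when \<open>u\<close> is the only one.\<close>

lemma repliable_uncovered:
  assumes v: "valid n (C \<union> M)" and dis: "vdisj C M" and C: "closed C" "mids C = {}"
    and M: "matching M" and xy: "{x, y} \<in> M" "x \<noteq> y" and u: "u < n" "u \<notin> \<Union>C \<union> \<Union>M"
  shows "repliable n (C \<union> M)"
proof -
  have Mp: "M \<subseteq> pairs {..<n}" and fin: "finite M" "finite (C \<union> M)" using validD(1,3)[OF v] by auto
  have deg0: "deg (C \<union> M) w = 0" if "w \<notin> \<Union>C \<union> \<Union>M" for w
    using that by (intro deg_eq_0) auto
  have degM: "deg (C \<union> M) w = deg M w" if "w \<in> \<Union>M" for w
    using deg_Un[OF dis, of w] that dis by (metis disjoint_iff)
  show ?thesis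
  proof (cases "\<exists>w<n. w \<noteq> u \<and> w \<notin> \<Union>C \<union> \<Union>M")
    case True
    then obtain w where w: "w < n" "w \<noteq> u" "w \<notin> \<Union>C \<union> \<Union>M" by blast
    have new: "{u, w} \<notin> C \<union> M" "{u, w} \<notin> M" using u(2) by auto
    have leg: "{u, w} \<in> legal n (C \<union> M)"
      unfolding legal_doubleton_iff[OF v] using u w new deg0 by simp
    have "matching (insert {u, w} M)"
      using M deg_insert[OF fin(1) new(2)] deg_eq_0[of u M] deg_eq_0[of w M] u(2) w(3)
      by (auto simp: matching_def)
    moreover have "valid n (C \<union> insert {u, w} M)"
      using leg legal_alt[OF v] by simp
    moreover have "vdisj C (insert {u, w} M)" using dis u(2) w(3) by auto
    ultimately have "shape n C (insert {u, w} M) {}" using C by (simp add: shape_def)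
    moreover have "insert {u, w} (C \<union> M) = C \<union> insert {u, w} M \<union> {}" by simp
    ultimately have "tame n (insert {u, w} (C \<union> M))" unfolding tame_def by blast
    then show ?thesis by (rule repliableI[OF leg])
  next
    case False
    \<comment> \<open>Joining the last isolated vertex \<open>u\<close> to \<open>{x, y}\<close>
      leaves a path on three vertices and no isolated vertex, as \<open>shape\<close> demands of a
      nonempty remainder.\<close>
    then have cover: "\<Union>C \<union> \<Union>M \<union> {u} = {..<n}"
      using u validD(1)[OF v] by (auto simp: pairs_def)
    let ?N = "M - {{x, y}}" and ?P = "insert {u, x} {{x, y}}"
    note r = matching_remove[OF M fin(1) xy(1)]
    have xM: "x \<in> \<Union>M" "y \<in> \<Union>M" using xy by blast+
    have ux: "u \<noteq> x" "u \<noteq> y" using xM u(2) by blast+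
    have new: "{u, x} \<notin> C \<union> M" using u(2) by blast
    have "deg (C \<union> M) x \<le> 1" using degM[OF xM(1)] M by (simp add: matching_def)
    moreover have "x < n" using xM Mp by (auto simp: pairs_def)
    ultimately have leg: "{u, x} \<in> legal n (C \<union> M)"
      unfolding legal_doubleton_iff[OF v] using u ux new deg0[of u] by simp
    have op: "open_path ?P u y"
      using ux by (intro open_path_extend open_path_edge xy(2)) auto
    have U: "\<Union>?P = {u, x, y}" by auto
    have UM: "\<Union>M = \<Union>?N \<union> {x, y}" using xy(1) by blast
    show ?thesis
    proof (rule tame_remainder[OF v leg _ _ _ _ C(1) r(1) C(2) _ op])
      show "insert {u, x} (C \<union> M) = C \<union> ?N \<union> ?P" using xy(1) by blast
      show "vdisj C ?N" using dis by blast
      show "vdisj C ?P" unfolding U using dis u(2) xM by blast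
      have "u \<notin> \<Union>?N" using u(2) by blast
      then show "vdisj ?N ?P" unfolding U using r(2) by auto
      show "card (\<Union>?P) \<le> 4" unfolding U by (simp add: card_insert_if)
      have "\<Union>C \<union> \<Union>?N \<union> {u, x, y} = \<Union>C \<union> (\<Union>?N \<union> {x, y}) \<union> {u}" by auto
      then show "\<Union>C \<union> \<Union>?N \<union> \<Union>?P = {..<n}" unfolding U UM[symmetric] cover .
    qed
  qed
qed

section \<open>The possible moves of Max and the replies to them\<close>

lemma tame_reply_isolated_isolated:
  assumes v: "valid n (insert {x, y} (C \<union> M))" and new: "{x, y} \<notin> C \<union> M" and xy: "x \<noteq> y"
    and dis: "vdisj C M" and C: "closed C" "mids C = {}" and M: "matching M"
    and x: "x \<notin> \<Union>C \<union> \<Union>M" and y: "y \<notin> \<Union>C \<union> \<Union>M"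
  shows "repliable n (insert {x, y} (C \<union> M))"
proof -
  let ?M = "insert {x, y} M"
  have E: "insert {x, y} (C \<union> M) = C \<union> ?M" by simp
  have fin: "finite M" using validD(3)[OF v] by simp
  have v': "valid n (C \<union> ?M)" using v unfolding E .
  have newM: "{x, y} \<notin> M" using new by simp
  have "deg ?M u \<le> 1" for u
  proof (cases "u \<in> {x, y}")
    case True
    then have "u \<notin> \<Union>M" using x y by blast
    then show ?thesis using deg_insert[OF fin newM, of u] deg_eq_0 by fastforce
  next
    case False
    then show ?thesis using deg_insert[OF fin newM, of u] M by (simp add: matching_def)
  qed
  then have M': "matching ?M" by (simp add: matching_def)
  have U: "\<Union>?M = {x, y} \<union> \<Union>M" by simp
  have dis': "vdisj C ?M" unfolding U using dis x y by blast
  \<comment> \<open>If an isolated vertex is left, the single edge that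
    \<open>repliable_uncovered\<close> asks for is the one Max has just claimed.\<close>
  show ?thesis
  proof (cases "\<exists>u<n. u \<notin> \<Union>C \<union> \<Union>?M")
    case True
    then obtain u where "u < n" "u \<notin> \<Union>C \<union> \<Union>?M" by blast
    then show ?thesis
      unfolding E by (intro repliable_uncovered[OF v' dis' C M' _ xy]) simp_all
  next
    case False
    have "\<Union>C \<union> \<Union>?M \<subseteq> {..<n}" using validD(1)[OF v'] by (auto simp: pairs_def)
    then have "\<Union>C \<union> \<Union>?M = {..<n}" using False by blast
    then show ?thesis unfolding E by (rule repliable_covered[OF v' dis' C M'])
  qed
qed

text \<open>Max has made a path on three vertices; Mini closes the triangle, which is too small to
  score.\<close>

lemma tame_reply_isolated_edge:
  assumes v: "valid n (insert {x, y} (C \<union> M))" and dis: "vdisj C M"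
    and C: "closed C" "mids C = {}" and M: "matching M"
    and x: "x \<notin> \<Union>C \<union> \<Union>M" and y: "y \<in> \<Union>M"
  shows "repliable n (insert {x, y} (C \<union> M))"
proof -
  have Mp: "M \<subseteq> pairs {..<n}" and fin: "finite M" using validD(1,3)[OF v] by auto
  obtain z where z: "{y, z} \<in> M" "z \<noteq> y" using matching_edge[OF Mp y] .
  let ?N = "M - {{y, z}}" and ?P = "insert {x, y} {{y, z}}"
  note r = matching_remove[OF M fin z(1)]
  have U: "\<Union>?P = {x, y, z}" by auto
  have yzM: "y \<in> \<Union>M" "z \<in> \<Union>M" using z(1) by blast+
  then have xyz: "x \<noteq> y" "x \<noteq> z" using x by blast+
  have op: "open_path ?P x z"
    using xyz z(2) by (intro open_path_extend open_path_edge) auto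
  have E: "insert {x, y} (C \<union> M) = C \<union> ?N \<union> {} \<union> ?P" using z(1) by blast
  show ?thesis
    unfolding E
  proof (rule repliable_close[OF _ _ _ _ _ _ _ C(1) r(1) _ op])
    show "valid n (C \<union> ?N \<union> {} \<union> ?P)" using v E by simp
    show "vdisj C ?N" using dis by blast
    show "vdisj C ?P" unfolding U using dis yzM x by blast
    have "x \<notin> \<Union>?N" using x by blast
    then show "vdisj ?N ?P" unfolding U using r(2) by auto
    show "{x, z} \<notin> ?P" using xyz z(2) by (auto simp: doubleton_eq_iff)
    have "card (\<Union>?P) \<le> 4" unfolding U by (simp add: card_insert_if)
    then show "card (\<Union>?P) \<le> 6" "4 < card (\<Union>?P) \<Longrightarrow> mids C = {} \<and> {} = {} \<and>
        \<Union>C \<union> \<Union>?N \<union> \<Union>{} \<union> \<Union>?P = {..<n}" by simp_all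
  qed (use C(2) in simp_all)
qed

lemma disjoint_mono: "A \<inter> B = {} \<Longrightarrow> A' \<subseteq> A \<Longrightarrow> B' \<subseteq> B \<Longrightarrow> A' \<inter> B' = {}"
  by blast

text \<open>Mini closes the four-cycle. It does not score, and the set of covered vertices is
  unchanged, so the reply is available also beside a remainder or a long cycle.\<close>

lemma tame_reply_edge_edge:
  assumes v: "valid n (insert {x, y} (C \<union> M \<union> R))" and s: "shape n C M R"
    and new: "{x, y} \<notin> C \<union> M \<union> R" and xy: "x \<noteq> y" "x \<in> \<Union>M" "y \<in> \<Union>M"
  shows "repliable n (insert {x, y} (C \<union> M \<union> R))"
proof -
  have Mp: "M \<subseteq> pairs {..<n}" and fin: "finite M" using validD(1,3)[OF v] by auto
  obtain w where w: "{x, w} \<in> M" "w \<noteq> x" using matching_edge[OF Mp xy(2)] .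
  obtain z where z: "{y, z} \<in> M" "z \<noteq> y" using matching_edge[OF Mp xy(3)] .
  have dis: "vdisj C M" "vdisj C R" "vdisj M R" and C: "closed C" and M: "matching M"
    using s by (simp_all only: shape_def)
  have "{x, y} \<notin> M" using new by simp
  note t = matching_two_edges[OF M fin w(1) z(1) this xy(1) w(2) z(2)]
  let ?N = "M - {{x, w}} - {{y, z}}" and ?P = "insert {x, y} ({{x, w}} \<union> {{y, z}})"
  have "insert {x, y} (C \<union> M \<union> R) = C \<union> insert {x, y} M \<union> R" by simp
  then have E: "insert {x, y} (C \<union> M \<union> R) = C \<union> ?N \<union> R \<union> ?P" unfolding t(3) by blast
  have sub: "\<Union>?N \<subseteq> \<Union>M" "\<Union>?P \<subseteq> \<Union>M" unfolding t(6) by blast+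
  have c4: "card (\<Union>?P) \<le> 4" unfolding t(5) by (rule card_four)
  show ?thesis
    unfolding E
  proof (rule repliable_close[OF _ _ dis(2) _ _ t(2) _ C t(1) _ t(4,7)])
    show "valid n (C \<union> ?N \<union> R \<union> ?P)" using v E by simp
    show "vdisj C ?N" by (rule disjoint_mono[OF dis(1) order_refl sub(1)])
    show "vdisj C ?P" by (rule disjoint_mono[OF dis(1) order_refl sub(2)])
    show "vdisj ?N R" by (rule disjoint_mono[OF dis(3) sub(1) order_refl])
    show "vdisj R ?P" using disjoint_mono[OF dis(3) sub(2) order_refl] by (simp only: Int_commute)
    have "\<Union>C \<union> \<Union>?N \<union> \<Union>R \<union> \<Union>?P = \<Union>C \<union> \<Union>M \<union> \<Union>R" unfolding t(6) by blast
    then show "mids C = {} \<and> R = {} \<or> \<Union>C \<union> \<Union>?N \<union> \<Union>R \<union> \<Union>?P = {..<n}"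
      using s by (simp only: shape_def)
    show "card (\<Union>?P) \<le> 6" using c4 by linarith
    show "mids C = {} \<and> R = {} \<and> \<Union>C \<union> \<Union>?N \<union> \<Union>R \<union> \<Union>?P = {..<n}" if "4 < card (\<Union>?P)"
      using that c4 by linarith
  qed (use s in \<open>simp_all only: shape_def\<close>)
qed

text \<open>The single edge adds two vertices to the at most four of \<open>R\<close>. Mini closes
  the resulting path, so the remainder disappears at the moment when a cycle may score.\<close>

lemma tame_reply_edge_remainder:
  assumes v: "valid n (insert {x, y} (C \<union> M \<union> R))" and s: "shape n C M R"
    and x: "x \<in> \<Union>M" and op: "open_path R y q"
  shows "repliable n (insert {x, y} (C \<union> M \<union> R))"
proof -
  have Mp: "M \<subseteq> pairs {..<n}" "R \<subseteq> pairs {..<n}" and fin: "finite M" "finite R"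
    using validD(1,3)[OF v] by auto
  obtain w where w: "{x, w} \<in> M" "w \<noteq> x" using matching_edge[OF Mp(1) x] .
  have yq: "y \<in> \<Union>R" "q \<in> \<Union>R" using open_path_ends[OF op] by blast+
  then have Rne: "R \<noteq> {}" by blast
  have dis: "vdisj C M" "vdisj C R" "vdisj M R" and C: "closed C" and M: "matching M"
    using s by (simp_all only: shape_def)
  \<comment> \<open>A nonempty remainder selects the other alternatives in \<open>shape\<close>:
    nothing scores yet and no vertex is isolated.\<close>
  have R4: "card (\<Union>R) \<le> 4" and mC: "mids C = {}" and cover: "\<Union>C \<union> \<Union>M \<union> \<Union>R = {..<n}"
    using s Rne by (simp_all add: shape_def)
  note r = matching_remove[OF M fin(1) w(1)]
  let ?N = "M - {{x, w}}" and ?P = "insert {x, y} ({{x, w}} \<union> R)"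
  have xw: "x \<in> \<Union>M" "w \<in> \<Union>M" using w(1) by blast+
  then have ne: "x \<notin> \<Union>R" "w \<notin> \<Union>R" "w \<noteq> y" "x \<noteq> q" "x \<noteq> y" using dis(3) yq by blast+
  have "open_path {{x, w}} w x" using open_path_edge[OF w(2)] by (simp add: insert_commute)
  moreover have "vdisj {{x, w}} R" using ne by simp
  ultimately have opP: "open_path ?P w q" using fin op by (intro open_path_join) simp_all
  have U: "\<Union>?P = {x, w} \<union> \<Union>R" using yq by auto
  have UM: "\<Union>M = \<Union>?N \<union> {x, w}" using w(1) by blast
  have E: "insert {x, y} (C \<union> M \<union> R) = C \<union> ?N \<union> {} \<union> ?P" using w(1) by blast
  have "\<Union>C \<union> \<Union>?N \<union> \<Union>{} \<union> \<Union>?P = \<Union>C \<union> (\<Union>?N \<union> {x, w}) \<union> \<Union>R" unfolding U by auto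
  then have cov: "\<Union>C \<union> \<Union>?N \<union> \<Union>{} \<union> \<Union>?P = {..<n}" unfolding UM[symmetric] cover .
  show ?thesis
    unfolding E
  proof (rule repliable_close[OF _ _ _ _ _ _ _ C r(1) _ opP])
    show "valid n (C \<union> ?N \<union> {} \<union> ?P)" using v E by simp
    show "vdisj C ?N" using dis by blast
    show "vdisj C ?P" unfolding U using dis xw by blast
    have "vdisj ?N R" using dis(3) by blast
    then show "vdisj ?N ?P" unfolding U using r(2) by auto
    have "{w, q} \<notin> R" using ne(2) by blast
    then show "{w, q} \<notin> ?P" using ne w(2) by (auto simp: doubleton_eq_iff)
    have "card (\<Union>?P) \<le> card {x, w} + card (\<Union>R)" unfolding U by (rule card_Un_le)
    moreover have "card {x, w} \<le> 2" by (simp add: card_insert_if)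
    ultimately show "card (\<Union>?P) \<le> 6" using R4 by linarith
    show "mids C = {} \<and> {} = {} \<and> \<Union>C \<union> \<Union>?N \<union> \<Union>{} \<union> \<Union>?P = {..<n}"
      using mC cov by blast
    show "mids C = {} \<and> {} = {} \<or> \<Union>C \<union> \<Union>?N \<union> \<Union>{} \<union> \<Union>?P = {..<n}"
      using mC by blast
  qed (use mC in simp_all)
qed

text \<open>Max himself closes the remainder, whose at most four vertices do not score. All vertices
  are then in \<open>C\<close> or \<open>M\<close>, and \<open>repliable_covered\<close> applies:
  Mini may have to open a new remainder.\<close>

lemma tame_reply_remainder_remainder:
  assumes v: "valid n (insert {x, y} (C \<union> M \<union> R))" and s: "shape n C M R"
    and new: "{x, y} \<notin> C \<union> M \<union> R" and op: "open_path R x y"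
  shows "repliable n (insert {x, y} (C \<union> M \<union> R))"
proof -
  have Rp: "R \<subseteq> pairs {..<n}" and fin: "finite R" using validD(1,3)[OF v] by auto
  have "x \<in> \<Union>R" using open_path_ends[OF op] by blast
  then have Rne: "R \<noteq> {}" by blast
  have dis: "vdisj C M" "vdisj C R" "vdisj M R" and C: "closed C" and M: "matching M"
    using s by (simp_all only: shape_def)
  have R4: "card (\<Union>R) \<le> 4" and mC: "mids C = {}" and cover: "\<Union>C \<union> \<Union>M \<union> \<Union>R = {..<n}"
    using s Rne by (simp_all add: shape_def)
  have "{x, y} \<notin> R" using new by simp
  note c = closed_insert_ends[OF fin op this]
  let ?R = "insert {x, y} R"
  have dis': "vdisj C ?R" using dis(2) c(2) by simp
  have "mids ?R = {}" using mids_small[of ?R] c(2) R4 finite_Union_pairs[OF Rp] by simp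
  then have m: "mids (C \<union> ?R) = {}" using mids_Un[OF dis'] mC by simp
  have U: "\<Union>(C \<union> ?R) = \<Union>C \<union> \<Union>R" unfolding Union_Un_distrib c(2) ..
  have E: "insert {x, y} (C \<union> M \<union> R) = (C \<union> ?R) \<union> M" by blast
  show ?thesis
    unfolding E
  proof (rule repliable_covered[OF _ _ closed_Un[OF C c(1) dis'] m M])
    show "valid n ((C \<union> ?R) \<union> M)" using v E by simp
    show "vdisj (C \<union> ?R) M" unfolding U using dis by blast
    show "\<Union>(C \<union> ?R) \<union> \<Union>M = {..<n}" unfolding U cover[symmetric] by blast
  qed
qed

text \<open>A legal move avoids \<open>C\<close>, so its ends lie in \<open>M\<close>, in
  \<open>R\<close> or among the isolated vertices. Isolated vertices and a nonempty \<open>R\<close>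
  exclude each other, which leaves the five preceding cases.\<close>

lemma tame_reply:
  assumes "tame n E" and e: "e \<in> legal n E"
  shows "repliable n (insert e E)"
proof -
  obtain C M R where E: "E = C \<union> M \<union> R" and s: "shape n C M R"
    using assms(1) unfolding tame_def by blast
  have vE: "valid n E" using s unfolding E shape_def by blast
  have v: "valid n (insert e E)" using e legal_alt[OF vE] by blast
  obtain x y where xy: "e = {x, y}" "x \<noteq> y" "x < n" "y < n" "{x, y} \<notin> E"
    "deg E x \<le> 1" "deg E y \<le> 1" using legalE[OF e vE] by metis
  have e': "e = {y, x}" using xy(1) by auto
  have dis: "vdisj C M" "vdisj C R" "vdisj M R" and C: "closed C" and M: "matching M"
    using s by (simp_all only: shape_def)
  have EC: "E = C \<union> (M \<union> R)" "vdisj C (M \<union> R)" unfolding E using dis by auto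
  have notC: "x \<notin> \<Union>C" "y \<notin> \<Union>C"
    using legal_not_in_closed[OF C EC(2)] xy(6,7) unfolding EC(1) by blast+
  show ?thesis
  proof (cases "x \<in> \<Union>M \<and> y \<in> \<Union>M")
    case True
    then show ?thesis
      using tame_reply_edge_edge[OF v[unfolded E xy(1)] s xy(5)[unfolded E] xy(2)]
      unfolding E xy(1) by blast
  next
    case notMM: False
    show ?thesis
    proof (cases "R = {}")
      case True
      then have EM: "E = C \<union> M" using E by simp
      \<comment> \<open>If \<open>C\<close> scored, every vertex would be covered; with
        \<open>R\<close> empty, both ends of the move would then lie in \<open>M\<close>.\<close>
      have "mids C = {}"
      proof (rule ccontr)
        assume "mids C \<noteq> {}"
        then have "\<Union>C \<union> \<Union>M \<union> \<Union>R = {..<n}" using s unfolding shape_def by blast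
        then show False using notMM notC xy(3,4) True by blast
      qed
      note isolated = tame_reply_isolated_edge[OF _ dis(1) C this M, of n]
        tame_reply_isolated_isolated[OF _ _ _ dis(1) C this M, of n]
      consider "x \<notin> \<Union>M" "y \<in> \<Union>M" | "y \<notin> \<Union>M" "x \<in> \<Union>M" | "x \<notin> \<Union>M" "y \<notin> \<Union>M"
        using notMM by blast
      then show ?thesis
      proof cases
        case 1
        then show ?thesis
          using isolated(1)[OF v[unfolded EM xy(1)]] notC unfolding EM xy(1) by blast
      next
        case 2
        then show ?thesis
          using isolated(1)[OF v[unfolded EM e']] notC unfolding EM e' by blast
      next
        case 3
        then show ?thesis
          using isolated(2)[OF v[unfolded EM xy(1)] xy(5)[unfolded EM] xy(2)] notC
          unfolding EM xy(1) by blast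
      qed
    next
      case False
      then obtain p q where pq: "open_path R p q" using s unfolding shape_def by blast
      have "\<Union>C \<union> \<Union>M \<union> \<Union>R = {..<n}" using s False unfolding shape_def by blast
      then have MR: "x \<in> \<Union>M \<or> x \<in> \<Union>R" "y \<in> \<Union>M \<or> y \<in> \<Union>R"
        using notC xy(3,4) by blast+
      \<comment> \<open>Inner vertices of the remainder have degree two already, so Max can use only
        its ends.\<close>
      have ends: "w = p \<or> w = q" if "w \<in> \<Union>R" "deg E w \<le> 1" for w
      proof (rule ccontr)
        assume "\<not> (w = p \<or> w = q)"
        then have "deg R w = 2" using pq that(1) unfolding open_path_def by blast
        moreover have "vdisj (C \<union> M) R" using dis by auto
        then have "deg E w = deg R w"
          using that(1) deg_Un[of "C \<union> M" R w] unfolding E by auto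
        ultimately show False using that(2) by simp
      qed
      have op: "\<exists>q'. open_path R w q'" if "w \<in> \<Union>R" "deg E w \<le> 1" for w
        using ends[OF that] pq open_path_sym[OF pq] by blast
      consider "x \<in> \<Union>M" "y \<in> \<Union>R" | "y \<in> \<Union>M" "x \<in> \<Union>R" | "x \<in> \<Union>R" "y \<in> \<Union>R"
        using MR notMM by blast
      then show ?thesis
      proof cases
        case 1
        obtain q' where "open_path R y q'" using op[OF 1(2) xy(7)] by blast
        then show ?thesis
          using tame_reply_edge_remainder[OF v[unfolded E xy(1)] s 1(1)] unfolding E xy(1) by blast
      next
        case 2
        obtain q' where "open_path R x q'" using op[OF 2(2) xy(6)] by blast
        then show ?thesis
          using tame_reply_edge_remainder[OF v[unfolded E e'] s 2(1)] unfolding E e' by blast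
      next
        case 3
        have "open_path R x y"
          using ends[OF 3(1) xy(6)] ends[OF 3(2) xy(7)] xy(2) pq open_path_sym[OF pq] by blast
        then show ?thesis
          using tame_reply_remainder_remainder[OF v[unfolded E xy(1)] s xy(5)[unfolded E]]
          unfolding E xy(1) by blast
      qed
    qed
  qed
qed

section \<open>The upper bound for either starting player\<close>

lemma tame_Maxi_le_6:
  assumes "tame n E"
  shows "gval n Maxi E \<le> 6"
proof (rule Mini_strategy[where good = "tame n"])
  show "valid n F" if "tame n F" for F using that unfolding tame_def shape_def by blast
  show "card (mids F) \<le> 6" if "tame n F" for F using that by (rule tame_card_mids)
  show "if legal n (insert e F) = {} then card (mids (insert e F)) \<le> 6
      else \<exists>e' \<in> legal n (insert e F). tame n (insert e' (insert e F))"
    if "tame n F" "e \<in> legal n F" for F e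
    using tame_reply[OF that] by (simp only: repliable_def)
qed (rule assms)

lemma tame_matching:
  assumes "valid n M" "matching M"
  shows "tame n M"
proof -
  have "mids ({} :: nat set set) = {}" by (simp add: mids_def path5_def)
  then have "shape n {} M {}" using assms by (simp add: shape_def)
  moreover have "M = {} \<union> M \<union> {}" by simp
  ultimately show ?thesis unfolding tame_def by blast
qed

lemma s1_le_6: "s1 n (path_graph 5) (star_graph 4) \<le> 6"
  unfolding s1_def by (intro tame_Maxi_le_6 tame_matching) (simp_all add: matching_def deg_eq_0)

text \<open>The invariant speaks of positions with Max to move. Whatever edge Mini claims first, it
  forms a matching; if there is no edge to claim, the score is 0.\<close>

lemma s2_le_6: "s2 n (path_graph 5) (star_graph 4) \<le> 6"
proof (cases "legal n {} = {}")
  case True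
  then show ?thesis
    unfolding s2_def gval_terminal[OF valid_empty True] by (simp add: mids_def path5_def)
next
  case False
  then obtain e where e: "e \<in> legal n {}" by auto
  have "matching {e}"
    using deg_insert[of "{}" e] by (auto simp: matching_def deg_eq_0)
  moreover have "valid n {e}" using e legal_alt[OF valid_empty] by blast
  ultimately have "gval n Maxi (insert e {}) \<le> 6" by (intro tame_Maxi_le_6 tame_matching)
  then show ?thesis unfolding s2_def by (rule gval_Mini_le[OF valid_empty e])
qed

theorem theorem1p3:
  shows "(\<forall>n\<ge>1. s1 n (path_graph 5) (star_graph 4) \<le> 6 \<and>
                 s2 n (path_graph 5) (star_graph 4) \<le> 6) \<and>
         (\<forall>n. (\<exists>k\<ge>2. n = 4 * k) \<or> (\<exists>k\<ge>1. n = 4 * k + 1) \<longrightarrow>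
                 s2 n (path_graph 5) (star_graph 4) \<ge> 5)"
proof (intro conjI allI impI s1_le_6 s2_le_6)
  fix n :: nat
  assume "(\<exists>k\<ge>2. n = 4 * k) \<or> (\<exists>k\<ge>1. n = 4 * k + 1)"
  then have "5 \<le> n" "n mod 4 \<le> 1" by auto
  then show "s2 n (path_graph 5) (star_graph 4) \<ge> 5" by (rule s2_ge_5)
qed

end
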